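(* Let $n\ge 2$ and let $\Omega\subset\mathbb{R}^n$ be a bounded domain that satisfies the separation property. Let $\delta,\tau\in(0,1)$ and $n-\delta\le\beta<n$. Suppose that for any $\gamma\in(0,1)$ there exists a constant $C>0$ such that for every open set $U\subset\Omega$ with $|U|/|\Omega|\le\gamma$, $$\mathcal{H}^\beta_\infty(U)\le C(1-\delta)\,\mathcal{P}_{\delta,\tau}(U,\Omega).$$ Then $\Omega$ is an $s$-diameter John domain with $$s=\frac{\delta\beta}{(n-\delta)(n-\beta)}.$$
   Context: A domain is a nonempty open connected set; $d(x)=d(x,\partial\Omega)=\operatorname{dist}(x,\partial\Omega)$; $|U|$ is Lebesgue measure. Separation property: there exist $x_0\in\Omega$ and $C_0\ge1$ such that for every $x\in\Omega$ there is a curve $\gamma:[0,1]\to\Omega$ with $\gamma(0)=x$, $\gamma(1)=x_0$, such that for each $t\in[0,1]$, with $B_t:=B(\gamma(t),C_0 d(\gamma(t),\partial\Omega))$, either $\gamma([0,t])\subset B_t$, or each $y\in\gamma([0,t])\setminus B_t$ and $x_0$ belong to different components of $\Omega\setminus\partial B_t$. A bounded domain $\Omega$ is an $s$-diameter John domain ($s\ge1$) if there are $C_J\ge1$ and $x_J\in\Omega$ such that each $x\in\Omega$ can be joined to $x_J$ by a rectifiable curve $\gamma:[0,1]\to\Omega$, $\gamma(0)=x$, $\gamma(1)=x_J$, with $C_J\,d(\gamma(t),\partial\Omega)>(\operatorname{diam}\gamma([0,t]))^s$ for all $t\in[0,1]$. For measurable $U\subset\Omega$, $$\mathcal{P}_{\delta,\tau}(U,\Omega):=\int_\Omega\int_{\{x\in\Omega:\,|x-y|<\tau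 d(y)\}}\frac{|\chi_U(x)-\chi_U(y)|}{|x-y|^{n+\delta}}\,dx\,dy.$$ Hausdorff content: $\mathcal{H}^\beta_\infty(A)=\inf\{\sum_i\omega_\beta r_i^\beta:A\subset\bigcup_iB(x_i,r_i)\}$ (countable coverings by balls), $\omega_\beta=\pi^{\beta/2}/\Gamma(\beta/2+1)$. *)

theory Defs
  imports "HOL-Analysis.Analysis"
begin

definition is_domain :: "'a::euclidean_space set \<Rightarrow> bool" where
  "is_domain \<Omega> \<longleftrightarrow> open \<Omega> \<and> connected \<Omega> \<and> \<Omega> \<noteq> {}"

(* Only meaningful when the frontier is nonempty (e.g. \<Omega> nonempty and bounded):
   infdist is 0 for the empty set. *)
definition bdist :: "'a::euclidean_space set \<Rightarrow> 'a \<Rightarrow> real" where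
  "bdist \<Omega> x = infdist x (frontier \<Omega>)"

(* "y and x0 belong to different components of \<Omega> - \<partial>B" is read as: no component of
   \<Omega> - \<partial>B contains both.  Points on the sphere \<partial>B lie in no component and are
   therefore unconstrained.  This is essential: balls are open, so if
   \<gamma>([0,t]) is not contained in B, then by continuity \<gamma>([0,t]) - B meets \<partial>B, and a
   reading that requires every y to lie in some component would make the second
   alternative unsatisfiable. *)
definition separation_property :: "'a::euclidean_space set \<Rightarrow> bool" where
  "separation_property \<Omega> \<longleftrightarrow>
     (\<exists>x0\<in>\<Omega>. \<exists>C0\<ge>1. \<forall>x\<in>\<Omega>. \<exists>\<gamma>.
        path \<gamma> \<and> path_image \<gamma> \<subseteq> \<Omega> \<and> pathstart \<gamma> = x \<and> pathfinish \<gamma> = x0 \<and>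
        (\<forall>t\<in>{0..1}.
           let B = ball (\<gamma> t) (C0 * bdist \<Omega> (\<gamma> t)) in
             \<gamma> ` {0..t} \<subseteq> B \<or>
             (\<forall>y \<in> \<gamma> ` {0..t} - B. \<not> connected_component (\<Omega> - frontier B) y x0)))"

definition rectifiable_path :: "(real \<Rightarrow> 'a::euclidean_space) \<Rightarrow> bool" where
  "rectifiable_path \<gamma> \<longleftrightarrow> path \<gamma> \<and>
     (\<exists>L. \<forall>N (t :: nat \<Rightarrow> real).
        (\<forall>i\<le>N. t i \<in> {0..1}) \<and> (\<forall>i<N. t i \<le> t (Suc i)) \<longrightarrow>
        (\<Sum>i<N. dist (\<gamma> (t i)) (\<gamma> (t (Suc i)))) \<le> L)"

definition diameter_John_domain :: "real \<Rightarrow> 'a::euclidean_space set \<Rightarrow> bool" where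
  "diameter_John_domain s \<Omega> \<longleftrightarrow>
     1 \<le> s \<and> is_domain \<Omega> \<and> bounded \<Omega> \<and>
     (\<exists>CJ\<ge>1. \<exists>xJ\<in>\<Omega>. \<forall>x\<in>\<Omega>. \<exists>\<gamma>.
        rectifiable_path \<gamma> \<and> path_image \<gamma> \<subseteq> \<Omega> \<and> pathstart \<gamma> = x \<and> pathfinish \<gamma> = xJ \<and>
        (\<forall>t\<in>{0..1}. CJ * bdist \<Omega> (\<gamma> t) > diameter (\<gamma> ` {0..t}) powr s))"

definition frac_perimeter ::
    "real \<Rightarrow> real \<Rightarrow> 'a::euclidean_space set \<Rightarrow> 'a set \<Rightarrow> ennreal" where
  "frac_perimeter \<delta> \<tau> U \<Omega> =
     (\<integral>\<^sup>+y\<in>\<Omega>. (\<integral>\<^sup>+x\<in>{x\<in>\<Omega>. norm (x - y) < \<tau> * bdist \<Omega> y}.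
        ennreal (\<bar>indicat_real U x - indicat_real U y\<bar> / norm (x - y) powr (real DIM('a) + \<delta>))
        \<partial>lebesgue) \<partial>lebesgue)"

(* Radii may be 0 and the corresponding open balls are empty, so finite coverings are
   included; since 0 powr \<beta> = 0, empty balls contribute nothing.
   unit_ball_vol \<beta> is \<pi>^(\<beta>/2) / \<Gamma>(\<beta>/2 + 1). *)
definition hausdorff_content :: "real \<Rightarrow> 'a::euclidean_space set \<Rightarrow> ennreal" where
  "hausdorff_content \<beta> A =
     Inf {(\<Sum>i. ennreal (unit_ball_vol \<beta> * r i powr \<beta>)) | (x :: nat \<Rightarrow> 'a) (r :: nat \<Rightarrow> real).
            (\<forall>i. 0 \<le> r i) \<and> A \<subseteq> (\<Union>i. ball (x i) (r i))}"

end

theory Submission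
  imports Defs
begin

text \<open>
  Fix a point \<open>c\<close> of a separation curve, put \<open>r = d(c)\<close>, and let \<open>U\<close> be the component of
  \<open>\<Omega> - \<partial>B(c, C\<^sub>0 r)\<close> that contains an earlier point of the curve far from \<open>c\<close>. As \<open>U\<close> misses a ball
  around \<open>x\<^sub>0\<close>, the content inequality applies to \<open>U - B(c, \<rho>)\<close> for every \<open>\<rho>\<close>. Averaging the
  perimeter over \<open>\<rho> \<in> [a, a + L]\<close> gives a \<open>\<rho>\<close> for which it is at most a constant times
  \<open>L\<^sup>-\<^sup>\<delta> |U - B(c, a)|\<close>, so
  \<open>|U - B(c, a + L)|\<^bsup>\<beta>/n\<^esup> \<le> K L\<^sup>-\<^sup>\<delta> |U - B(c, a)|\<close>.
  With \<open>a, L\<close> comparable to \<open>r\<close> (where only the part of \<open>U\<close> at distance at most a multiple of \<open>r\<close>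
  from \<open>c\<close> contributes) the left side is at most a multiple of \<open>r\<^bsup>n-\<delta>\<^esup>\<close>. From there the measure
  is halved by steps \<open>L\<^sub>k\<close> that form a geometric series whose sum is a multiple of \<open>r\<^bsup>1/s\<^esup>\<close>. Hence
  \<open>U\<close> lies within that distance of \<open>c\<close>, which is the John condition. A polynomial approximation
  makes the curve rectifiable.
\<close>

section \<open>Integral of the truncated kernel over dyadic shells\<close>

lemma dyadic_below:
  fixes t L :: real
  assumes "0 < t" "t \<le> L"
  obtains k :: nat where "L * (1/2)^k / 2 < t" "t \<le> L * (1/2)^k"
proof -
  have L: "L > 0" using assms by simp
  have ex: "\<exists>k. (1/2::real)^k < t / L"
    using real_arch_pow_inv[of "t/L" "1/2"] assms L by simp
  \<comment> \<open>The least exponent overshoots by one; its predecessor is the index of the shell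
    containing \<open>t\<close>.\<close>
  define k where "k = (LEAST k. (1/2::real)^k < t / L)"
  have k: "(1/2::real)^k < t / L" unfolding k_def using ex by (rule LeastI_ex)
  have "k \<noteq> 0"
  proof
    assume "k = 0" then show False using k assms L by (simp add: field_simps)
  qed
  then obtain j where j: "k = Suc j" by (cases k) auto
  have "\<not> (1/2::real)^j < t / L" using not_less_Least[of j "\<lambda>k. (1/2::real)^k < t / L"] j by (simp add: k_def)
  then show thesis using that[of j] k L j by (simp add: field_simps)
qed

lemma dyadic_above:
  fixes t L :: real
  assumes "0 < L" "L < t"
  obtains k :: nat where "L * 2^k < t" "t \<le> 2 * L * 2^k"
proof -
  have ex: "\<exists>k. t / L \<le> 2^k"
    using real_arch_pow[of 2 "t/L"] by (auto intro: less_imp_le)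
  define k where "k = (LEAST k. t / L \<le> 2^k)"
  have k: "t / L \<le> 2^k" unfolding k_def using ex by (rule LeastI_ex)
  have "k \<noteq> 0"
  proof
    assume "k = 0" then show False using k assms by (simp add: field_simps)
  qed
  then obtain j where j: "k = Suc j" by (cases k) auto
  have "\<not> t / L \<le> 2^j" using not_less_Least[of j "\<lambda>k. t / L \<le> 2^k"] j by (simp add: k_def)
  then show thesis using that[of j] k assms j by (simp add: field_simps)
qed

lemma ennreal_le_suminf: "f k \<le> (\<Sum>k. f k)" for f :: "nat \<Rightarrow> ennreal"
  using sum_le_suminf[of f "{k}"] by simp

text \<open>Termwise integration leaves a geometric series. It serves both for shells shrinking to
  the singularity and for shells growing to infinity; enlarging a shell to a ball changes its volume
  only by a constant factor.\<close>

lemma nn_integral_geometric_cballs: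
  fixes z :: "'a::euclidean_space" and A q :: real and \<alpha> R :: "nat \<Rightarrow> real"
  assumes "\<And>k. \<alpha> k \<ge> 0" "\<And>k. R k \<ge> 0" "0 \<le> q" "q < 1"
    and "\<And>k. \<alpha> k * (unit_ball_vol DIM('a) * R k ^ DIM('a)) = A * q ^ k"
  shows "(\<integral>\<^sup>+w. (\<Sum>k. ennreal (\<alpha> k) * indicator (cball z (R k)) w) \<partial>lborel) = ennreal (A / (1 - q))"
proof -
  have "(\<integral>\<^sup>+w. (\<Sum>k. ennreal (\<alpha> k) * indicator (cball z (R k)) w) \<partial>lborel)
      = (\<Sum>k. \<integral>\<^sup>+w. ennreal (\<alpha> k) * indicator (cball z (R k)) w \<partial>lborel)"
    by (rule nn_integral_suminf) (intro borel_measurable_times_ennreal borel_measurable_indicator, auto)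
  also have "\<dots> = (\<Sum>k. ennreal (A * q ^ k))"
  proof (rule suminf_cong)
    fix k
    have "(\<integral>\<^sup>+w. ennreal (\<alpha> k) * indicator (cball z (R k)) w \<partial>lborel)
        = ennreal (\<alpha> k) * emeasure lborel (cball z (R k))"
      by (rule nn_integral_cmult_indicator) simp
    also have "\<dots> = ennreal (\<alpha> k * (unit_ball_vol DIM('a) * R k ^ DIM('a)))"
      using assms(1,2) by (simp add: emeasure_cball ennreal_mult)
    finally show "(\<integral>\<^sup>+w. ennreal (\<alpha> k) * indicator (cball z (R k)) w \<partial>lborel) = ennreal (A * q ^ k)"
      using assms(5) by simp
  qed
  also have "\<dots> = ennreal (A / (1 - q))"
  proof (rule suminf_ennreal_eq)
    show "0 \<le> A * q ^ k" for k
    proof -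
      have "0 \<le> \<alpha> k * (unit_ball_vol DIM('a) * R k ^ DIM('a))"
        using assms(1,2) by (intro mult_nonneg_nonneg) auto
      then show ?thesis using assms(5) by simp
    qed
    show "(\<lambda>k. A * q ^ k) sums (A / (1 - q))"
      using sums_mult[OF geometric_sums[of q], of A] assms by simp
  qed
  finally show ?thesis .
qed

text \<open>For \<open>norm (z - w) \<le> L\<close> the integrand is the power
  \<open>1 - n - \<delta>\<close> of the distance, integrable at \<open>z\<close> because \<delta> <
  1. Beyond \<open>L\<close> it is \<open>L\<close> times the power \<open>- n - \<delta>\<close>,
  integrable at infinity because \<delta> > 0. Both parts scale like
  \<open>L powr (1 - \<delta>)\<close>.\<close>

lemma nn_integral_kernel_le:
  fixes \<delta> :: real
  assumes "0 < \<delta>" "\<delta> < 1"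
  obtains K where "K > 0" "\<And>(z::'a::euclidean_space) L. L > 0 \<Longrightarrow>
    (\<integral>\<^sup>+w. ennreal (min L (norm (z - w)) / norm (z - w) powr (real DIM('a) + \<delta>)) \<partial>lborel)
      \<le> ennreal (K * L powr (1 - \<delta>))"
proof -
  define n where "n = real DIM('a)"
  have n1: "n \<ge> 1" unfolding n_def by (simp add: Suc_leI)
  define \<omega> where "\<omega> = unit_ball_vol (real DIM('a))"
  have \<omega>: "\<omega> > 0" unfolding \<omega>_def by (rule unit_ball_vol_pos) simp
  define A1 where "A1 = \<omega> * (1/2) powr (1 - n - \<delta>)"
  define A2 where "A2 = \<omega> * 2 powr n"
  \<comment> \<open>\<open>q1\<close> and \<open>q2\<close> are the ratios of the two geometric
    series: the volume of a shell times the size of the kernel on it.\<close>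
  define q1 where "q1 = (1/2::real) powr (1 - \<delta>)"
  define q2 where "q2 = (2::real) powr (-\<delta>)"
  have q1: "0 < q1" "q1 < 1"
    using assms powr_less_mono2[of "1 - \<delta>" "1/2" 1] unfolding q1_def by auto
  have q2: "0 < q2" "q2 < 1" using assms unfolding q2_def by (auto simp: powr_less_one powr_minus_divide)
  define K where "K = A1 / (1 - q1) + A2 / (1 - q2)"
  have A: "A1 > 0" "A2 > 0" unfolding A1_def A2_def using \<omega> by auto
  have K: "K > 0" unfolding K_def using A q1 q2 by (auto intro!: add_pos_pos divide_pos_pos)
  show thesis
  proof (rule that[OF K])
    fix z :: 'a and L :: real assume L: "L > 0"
    \<comment> \<open>\<open>\<alpha> k\<close> and \<open>\<alpha>' k\<close> are the values of the
      kernel at the inner radius of the k-th shell, where it is largest as the exponents are not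
      positive; \<open>R k\<close> and \<open>R' k\<close> are the outer radii.\<close>
    define \<alpha> where "\<alpha> k = (L * (1/2)^k / 2) powr (1 - n - \<delta>)" for k :: nat
    define \<alpha>' where "\<alpha>' k = L * (L * 2^k) powr (- n - \<delta>)" for k :: nat
    define R where "R k = L * (1/2)^k" for k :: nat
    define R' where "R' k = 2 * L * 2^k" for k :: nat
    have "ennreal (min L (norm (z - w)) / norm (z - w) powr (n + \<delta>))
       \<le> (\<Sum>k. ennreal (\<alpha> k) * indicator (cball z (R k)) w)
        + (\<Sum>k. ennreal (\<alpha>' k) * indicator (cball z (R' k)) w)" (is "?l \<le> ?s1 + ?s2") for w
    proof (cases "w = z")
      case False
      define t where "t = norm (z - w)"
      have t: "t > 0" using False unfolding t_def by auto
      show ?thesis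
      proof (cases "t \<le> L")
        case True
        obtain k where k: "L * (1/2)^k / 2 < t" "t \<le> L * (1/2)^k"
          using dyadic_below[OF t True] .
        have "min L t / t powr (n + \<delta>) = t powr (1 - n - \<delta>)"
          using True t by (simp add: powr_diff powr_add field_simps)
        also have "\<dots> \<le> \<alpha> k" unfolding \<alpha>_def using k n1 assms L
          by (intro powr_mono2') auto
        finally have "?l \<le> ennreal (\<alpha> k) * indicator (cball z (R k)) w"
          using k unfolding t_def R_def by (auto simp: dist_norm indicator_def intro: ennreal_leI)
        also have "\<dots> \<le> ?s1"
          by (rule ennreal_le_suminf)
        finally show ?thesis by (rule order_trans) simp
      next
        case F: False
        obtain k where k: "L * 2^k < t" "t \<le> 2 * L * 2^k"
          using dyadic_above[OF L, of t] F by auto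
        have "min L t / t powr (n + \<delta>) = L * t powr (- n - \<delta>)"
          using F t by (simp add: powr_diff powr_add powr_minus field_simps)
        also have "\<dots> \<le> \<alpha>' k" unfolding \<alpha>'_def using k n1 assms L
          by (intro mult_left_mono powr_mono2') auto
        finally have "?l \<le> ennreal (\<alpha>' k) * indicator (cball z (R' k)) w"
          using k unfolding t_def R'_def by (auto simp: dist_norm indicator_def intro: ennreal_leI)
        also have "\<dots> \<le> ?s2"
          by (rule ennreal_le_suminf)
        finally show ?thesis by (rule order_trans) simp
      qed
    \<comment> \<open>For \<open>w = z\<close> the numerator vanishes and the left side is
      0.\<close>
    qed simp
    then have "(\<integral>\<^sup>+w. ennreal (min L (norm (z - w)) / norm (z - w) powr (n + \<delta>)) \<partial>lborel)
       \<le> (\<integral>\<^sup>+w. (\<Sum>k. ennreal (\<alpha> k) * indicator (cball z (R k)) w)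
        + (\<Sum>k. ennreal (\<alpha>' k) * indicator (cball z (R' k)) w) \<partial>lborel)"
      by (rule nn_integral_mono)
    also have "\<dots> = (\<integral>\<^sup>+w. (\<Sum>k. ennreal (\<alpha> k) * indicator (cball z (R k)) w) \<partial>lborel)
        + (\<integral>\<^sup>+w. (\<Sum>k. ennreal (\<alpha>' k) * indicator (cball z (R' k)) w) \<partial>lborel)"
      by (rule nn_integral_add)
        (auto intro!: borel_measurable_suminf_order borel_measurable_times_ennreal borel_measurable_indicator)
    also have "(\<integral>\<^sup>+w. (\<Sum>k. ennreal (\<alpha> k) * indicator (cball z (R k)) w) \<partial>lborel)
        = ennreal (A1 * L powr (1 - \<delta>) / (1 - q1))"
    proof (rule nn_integral_geometric_cballs)
      fix k :: nat
      define p where "p = (1/2::real)^k"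
      have p: "p > 0" unfolding p_def by simp
      have Rp: "(L * p) ^ DIM('a) = (L * p) powr n"
        unfolding n_def using L p by (simp add: powr_realpow)
      have "(L * p / 2) powr (1 - n - \<delta>) * (L * p) powr n
          = (1/2) powr (1 - n - \<delta>) * ((L * p) powr (1 - n - \<delta>) * (L * p) powr n)"
        using L p powr_mult[of "L * p" "1/2" "1 - n - \<delta>"] by (simp add: mult_ac)
      also have "(L * p) powr (1 - n - \<delta>) * (L * p) powr n = (L * p) powr (1 - \<delta>)"
        by (simp add: powr_add[symmetric])
      also have "\<dots> = L powr (1 - \<delta>) * q1 ^ k"
        using L p unfolding q1_def p_def
        by (simp add: powr_mult powr_realpow[symmetric] powr_powr mult.commute)
      finally show "\<alpha> k * (unit_ball_vol DIM('a) * R k ^ DIM('a)) = A1 * L powr (1 - \<delta>) * q1 ^ k"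
        unfolding \<alpha>_def R_def p_def[symmetric] A1_def Rp \<omega>_def[symmetric] by (simp add: mult_ac)
    qed (use q1 L in \<open>auto simp: \<alpha>_def R_def\<close>)
    also have "(\<integral>\<^sup>+w. (\<Sum>k. ennreal (\<alpha>' k) * indicator (cball z (R' k)) w) \<partial>lborel)
        = ennreal (A2 * L powr (1 - \<delta>) / (1 - q2))"
    proof (rule nn_integral_geometric_cballs)
      fix k :: nat
      define p where "p = (2::real)^k"
      have p: "p > 0" unfolding p_def by simp
      have Rp: "(2 * L * p) ^ DIM('a) = 2 powr n * (L * p) powr n"
        unfolding n_def using L p by (simp add: powr_realpow power_mult_distrib mult_ac)
      have "L * (L * p) powr (- n - \<delta>) * (L * p) powr n
          = L * (L * p) powr (- \<delta>)"
        by (simp add: powr_add[symmetric])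
      also have "\<dots> = L powr (1 - \<delta>) * q2 ^ k"
      proof -
        have "p powr (- \<delta>) = q2 ^ k"
          unfolding q2_def p_def by (simp add: powr_realpow[symmetric] powr_powr mult.commute)
        moreover have "L * L powr (- \<delta>) = L powr (1 - \<delta>)"
          using L by (simp add: powr_diff powr_minus_divide)
        ultimately show ?thesis using L p by (simp add: powr_mult mult.assoc[symmetric])
      qed
      finally have e: "L * (L * p) powr (- n - \<delta>) * (L * p) powr n = L powr (1 - \<delta>) * q2 ^ k" .
      have "\<alpha>' k * (unit_ball_vol DIM('a) * R' k ^ DIM('a))
          = A2 * (L * (L * p) powr (- n - \<delta>) * (L * p) powr n)"
        unfolding \<alpha>'_def R'_def p_def[symmetric] A2_def Rp \<omega>_def[symmetric] by (simp add: mult_ac)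
      then show "\<alpha>' k * (unit_ball_vol DIM('a) * R' k ^ DIM('a)) = A2 * L powr (1 - \<delta>) * q2 ^ k"
        unfolding e by simp
    qed (use q2 L in \<open>auto simp: \<alpha>'_def R'_def\<close>)
    also have "ennreal (A1 * L powr (1 - \<delta>) / (1 - q1)) + ennreal (A2 * L powr (1 - \<delta>) / (1 - q2))
        = ennreal (K * L powr (1 - \<delta>))"
      using A q1 q2 unfolding K_def by (subst ennreal_plus[symmetric]) (auto simp: algebra_simps)
    finally show "(\<integral>\<^sup>+w. ennreal (min L (norm (z - w)) / norm (z - w) powr (real DIM('a) + \<delta>)) \<partial>lborel)
      \<le> ennreal (K * L powr (1 - \<delta>))" unfolding n_def .
  qed
qed

section \<open>Hausdorff content against Lebesgue measure\<close>

text \<open>In a covering of total weight below \<open>2 * S\<close> each single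
  \<open>r i powr \<beta>\<close> is at most \<open>T\<close>. So the volume of a ball, of order
  \<open>r i powr \<beta> * r i powr (n - \<beta>)\<close>, is at most a fixed multiple of its
  weight, and the weights sum up.\<close>

lemma emeasure_le_of_hausdorff_content_le:
  fixes A :: "'a::euclidean_space set"
  assumes "0 < \<beta>" "\<beta> \<le> real DIM('a)" "A \<in> sets borel" "0 < S"
    and "hausdorff_content \<beta> A \<le> ennreal S"
  shows "emeasure lborel A \<le>
    ennreal (unit_ball_vol (real DIM('a)) * (2 * S / unit_ball_vol \<beta>) powr (real DIM('a) / \<beta>))"
proof -
  define n where "n = real DIM('a)"
  have n1: "n > 0" unfolding n_def by simp
  define \<omega> where "\<omega> = unit_ball_vol \<beta>"
  have \<omega>: "\<omega> > 0" unfolding \<omega>_def using assms by (intro unit_ball_vol_pos) simp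
  define \<omega>n where "\<omega>n = unit_ball_vol n"
  have \<omega>n: "\<omega>n > 0" unfolding \<omega>n_def using n1 by (intro unit_ball_vol_pos) simp
  define T where "T = 2 * S / \<omega>"
  have T: "T > 0" unfolding T_def using assms \<omega> by simp
  \<comment> \<open>The factor 2 makes the inequality strict, so that some covering realises it
    although the infimum need not be attained.\<close>
  have "hausdorff_content \<beta> A < ennreal (2 * S)"
    using assms(5) by (rule le_less_trans) (use assms(4) in \<open>simp add: ennreal_less_iff\<close>)
  then obtain x r where r0: "\<And>i. 0 \<le> r i" and cov: "A \<subseteq> (\<Union>i::nat. ball (x i) (r i))"
    and S: "(\<Sum>i. ennreal (\<omega> * r i powr \<beta>)) < ennreal (2 * S)"
    unfolding hausdorff_content_def Inf_less_iff \<omega>_def by auto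
  define c where "c = \<omega>n * T powr ((n - \<beta>) / \<beta>) / \<omega>"
  have c: "c > 0" unfolding c_def using \<omega> \<omega>n T by simp
  have ball_le: "emeasure lborel (ball (x i) (r i)) \<le> ennreal c * ennreal (\<omega> * r i powr \<beta>)" for i
  proof (cases "r i = 0")
    case False
    then have ri: "r i > 0" using r0[of i] by simp
    have "ennreal (\<omega> * r i powr \<beta>) < ennreal (2 * S)"
      using ennreal_le_suminf[of "\<lambda>i. ennreal (\<omega> * r i powr \<beta>)" i] S by (rule le_less_trans)
    then have "r i powr \<beta> \<le> T" unfolding T_def using \<omega> assms
      by (simp add: ennreal_less_iff field_simps)
    then have "(r i powr \<beta>) powr ((n - \<beta>) / \<beta>) \<le> T powr ((n - \<beta>) / \<beta>)"
      using assms by (intro powr_mono2) (auto simp: n_def)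
    then have le: "r i powr (n - \<beta>) \<le> T powr ((n - \<beta>) / \<beta>)" using assms by (simp add: powr_powr)
    have "\<omega>n * r i ^ DIM('a) = \<omega>n * (r i powr \<beta> * r i powr (n - \<beta>))"
      using ri by (simp add: powr_add[symmetric] n_def powr_realpow)
    also have "\<dots> \<le> \<omega>n * (r i powr \<beta> * T powr ((n - \<beta>) / \<beta>))"
      using le \<omega>n by (intro mult_left_mono) auto
    also have "\<dots> = c * (\<omega> * r i powr \<beta>)" unfolding c_def using \<omega> by simp
    finally show ?thesis using ri c \<omega>
      by (simp add: emeasure_ball ennreal_mult[symmetric] \<omega>n_def n_def ennreal_leI)
  qed simp
  have "emeasure lborel A \<le> emeasure lborel (\<Union>i. ball (x i) (r i))"
    using cov by (intro emeasure_mono) auto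
  also have "\<dots> \<le> (\<Sum>i. emeasure lborel (ball (x i) (r i)))"
    by (rule emeasure_subadditive_countably) auto
  also have "\<dots> \<le> (\<Sum>i. ennreal c * ennreal (\<omega> * r i powr \<beta>))"
    by (intro suminf_le ball_le) auto
  also have "\<dots> = ennreal c * (\<Sum>i. ennreal (\<omega> * r i powr \<beta>))" by simp
  also have "\<dots> \<le> ennreal c * ennreal (2 * S)" using S by (intro mult_left_mono) auto
  also have "\<dots> = ennreal (c * (2 * S))" using c assms by (simp add: ennreal_mult)
  also have "c * (2 * S) = \<omega>n * (T powr ((n - \<beta>) / \<beta>) * T)" unfolding c_def T_def using \<omega> by simp
  also have "T powr ((n - \<beta>) / \<beta>) * T = T powr ((n - \<beta>) / \<beta> + 1)" using T by (simp add: powr_add)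
  also have "(n - \<beta>) / \<beta> + 1 = n / \<beta>" using assms by (simp add: field_simps)
  finally show ?thesis unfolding T_def \<omega>_def \<omega>n_def n_def .
qed

section \<open>Fractional perimeter of a set with a ball removed\<close>

text \<open>
  The two alternatives for a pair \<open>z \<in> U - cball c \<rho>\<close>, \<open>w \<notin> U - cball c \<rho>\<close>: either \<open>w\<close> lies in the
  ball, or \<open>w \<notin> U\<close>; then the segment from \<open>z\<close> to \<open>w\<close> meets the frontier of \<open>U\<close>, which is close
  to \<open>c\<close>, so it is long.
\<close>
definition crossing_kernel :: "real \<Rightarrow> 'a::euclidean_space \<Rightarrow> real \<Rightarrow> real \<Rightarrow> 'a \<Rightarrow> 'a \<Rightarrow> real" where
  "crossing_kernel \<delta> c L \<rho> z w =
    (if norm (w - c) \<le> \<rho> \<and> \<rho> < norm (z - c) \<or> L \<le> norm (z - w)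
     then 1 / norm (z - w) powr (real DIM('a) + \<delta>) else 0)"

lemma measurable_crossing_kernel [measurable (raw)]:
  assumes [measurable]: "f \<in> borel_measurable M" "g \<in> borel_measurable M" "h \<in> borel_measurable M"
  shows "(\<lambda>x. crossing_kernel \<delta> c L (f x) (g x) (h x)) \<in> borel_measurable M"
  unfolding crossing_kernel_def by measurable

text \<open>If \<open>L \<le> norm (z - w)\<close>, every level in the interval may count, over a
  length \<open>L\<close>. Otherwise only the levels between \<open>norm (w - c)\<close> and
  \<open>norm (z - c)\<close> do, and by the triangle inequality these span at most
  \<open>norm (z - w)\<close>.\<close>

lemma nn_integral_crossing_kernel_le:
  fixes z w c :: "'a::euclidean_space"
  assumes "0 < L"
  shows "(\<integral>\<^sup>+\<rho>. ennreal (crossing_kernel \<delta> c L \<rho> z w) * indicator {a..a + L} \<rho> \<partial>lborel)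
    \<le> ennreal (min L (norm (z - w)) / norm (z - w) powr (real DIM('a) + \<delta>))"
proof -
  define k where "k = 1 / norm (z - w) powr (real DIM('a) + \<delta>)"
  have k: "k \<ge> 0" unfolding k_def by simp
  have *: "(\<integral>\<^sup>+\<rho>. ennreal (crossing_kernel \<delta> c L \<rho> z w) * indicator {a..a + L} \<rho> \<partial>lborel)
    \<le> ennreal (k * (q - p))" if "p \<le> q" and
      "\<And>\<rho>. crossing_kernel \<delta> c L \<rho> z w \<noteq> 0 \<Longrightarrow> a \<le> \<rho> \<Longrightarrow> \<rho> \<le> a + L \<Longrightarrow> p \<le> \<rho> \<and> \<rho> \<le> q" for p q
  proof -
    have "(\<integral>\<^sup>+\<rho>. ennreal (crossing_kernel \<delta> c L \<rho> z w) * indicator {a..a + L} \<rho> \<partial>lborel)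
      \<le> (\<integral>\<^sup>+\<rho>. ennreal k * indicator {p..q} \<rho> \<partial>lborel)"
    proof (rule nn_integral_mono)
      fix \<rho>
      show "ennreal (crossing_kernel \<delta> c L \<rho> z w) * indicator {a..a + L} \<rho> \<le> ennreal k * indicator {p..q} \<rho>"
        using that(2)[of \<rho>]
        by (cases "crossing_kernel \<delta> c L \<rho> z w = 0")
          (auto simp: indicator_def crossing_kernel_def k_def split: if_splits)
    qed
    also have "\<dots> = ennreal k * emeasure lborel {p..q}" by (rule nn_integral_cmult_indicator) simp
    also have "\<dots> = ennreal (k * (q - p))" using that(1) k by (simp add: ennreal_mult)
    finally show ?thesis .
  qed
  show ?thesis
  proof (cases "L \<le> norm (z - w)")
    case True
    then show ?thesis using *[of a "a + L"] assms by (simp add: k_def)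
  next
    case F: False
    show ?thesis
    proof (cases "norm (w - c) \<le> norm (z - c)")
      case True
      have "(\<integral>\<^sup>+\<rho>. ennreal (crossing_kernel \<delta> c L \<rho> z w) * indicator {a..a + L} \<rho> \<partial>lborel)
        \<le> ennreal (k * (norm (z - c) - norm (w - c)))"
        using True F by (intro *) (auto simp: crossing_kernel_def split: if_splits)
      also have "\<dots> \<le> ennreal (k * min L (norm (z - w)))"
        using F norm_triangle_ineq2[of "z - c" "w - c"] k
        by (intro ennreal_leI mult_left_mono) auto
      finally show ?thesis by (simp add: k_def)
    next
      case False
      then have "crossing_kernel \<delta> c L \<rho> z w = 0" for \<rho>
        using F by (auto simp: crossing_kernel_def)
      then show ?thesis by simp
    qed
  qed
qed

text \<open>A mean value argument: if the bound failed at every level, integration over the interval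
  would give at least \<open>2 * K * m * L powr (1 - \<delta>)\<close>, whereas exchanging the
  integrals bounds it by half of that.\<close>

lemma exists_level_crossing_kernel_le:
  fixes c :: "'a::euclidean_space"
  assumes "K > 0" and K: "\<And>z::'a. (\<integral>\<^sup>+w. ennreal (min L (norm (z - w)) / norm (z - w) powr (real DIM('a) + \<delta>)) \<partial>lborel)
      \<le> ennreal (K * L powr (1 - \<delta>))"
    and "L > 0" "m > 0" and [measurable]: "V \<in> sets borel" and m: "emeasure lborel V \<le> ennreal m"
  obtains \<rho> where "a \<le> \<rho>" "\<rho> \<le> a + L"
    "(\<integral>\<^sup>+z. \<integral>\<^sup>+w. ennreal (crossing_kernel \<delta> c L \<rho> z w) * indicator V z \<partial>lborel \<partial>lborel)
      \<le> ennreal (2 * K * m * L powr (- \<delta>))"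
proof (rule ccontr)
  note that' = that
  define B where "B = 2 * K * m * L powr (- \<delta>)"
  define G where "G \<rho> = (\<integral>\<^sup>+z. \<integral>\<^sup>+w. ennreal (crossing_kernel \<delta> c L \<rho> z w) * indicator V z \<partial>lborel \<partial>lborel)" for \<rho>
  define F where "F \<rho> z w = ennreal (crossing_kernel \<delta> c L \<rho> z w) * indicator V z * indicator {a..a + L} \<rho>"
    for \<rho> :: real and z w :: 'a
  assume "\<not> thesis"
  then have G: "G \<rho> \<ge> ennreal B" if "a \<le> \<rho>" "\<rho> \<le> a + L" for \<rho>
    using that' that unfolding G_def B_def by (meson linear)
  have "ennreal (2 * (K * m * L powr (1 - \<delta>))) = ennreal B * ennreal L"
    using assms unfolding B_def by (subst ennreal_mult[symmetric]) (auto simp: powr_diff powr_minus_divide)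
  also have "\<dots> = (\<integral>\<^sup>+\<rho>. ennreal B * indicator {a..a + L} \<rho> \<partial>lborel)"
    using assms by (subst nn_integral_cmult_indicator) auto
  also have "\<dots> \<le> (\<integral>\<^sup>+\<rho>. G \<rho> * indicator {a..a + L} \<rho> \<partial>lborel)"
    using G by (intro nn_integral_mono) (auto simp: indicator_def)
  also have "\<dots> = (\<integral>\<^sup>+\<rho>. \<integral>\<^sup>+z. \<integral>\<^sup>+w. F \<rho> z w \<partial>lborel \<partial>lborel \<partial>lborel)"
    unfolding G_def F_def by (simp add: nn_integral_multc)
  \<comment> \<open>Two applications of Tonelli move the integral over \<rho> inside, where
    \<open>z\<close> and \<open>w\<close> are fixed.\<close>
  also have "\<dots> = (\<integral>\<^sup>+z. \<integral>\<^sup>+\<rho>. \<integral>\<^sup>+w. F \<rho> z w \<partial>lborel \<partial>lborel \<partial>lborel)"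
    unfolding F_def by (rule lborel_pair.Fubini'[symmetric]) measurable
  also have "\<dots> = (\<integral>\<^sup>+z. \<integral>\<^sup>+w. \<integral>\<^sup>+\<rho>. F \<rho> z w \<partial>lborel \<partial>lborel \<partial>lborel)"
    unfolding F_def by (intro nn_integral_cong lborel_pair.Fubini'[symmetric]) measurable
  also have "\<dots> \<le> (\<integral>\<^sup>+z. \<integral>\<^sup>+w. ennreal (min L (norm (z - w)) / norm (z - w) powr (real DIM('a) + \<delta>)) * indicator V z \<partial>lborel \<partial>lborel)"
  proof (intro nn_integral_mono)
    fix z w :: 'a
    show "(\<integral>\<^sup>+\<rho>. F \<rho> z w \<partial>lborel) \<le> ennreal (min L (norm (z - w)) / norm (z - w) powr (real DIM('a) + \<delta>)) * indicator V z"
      using nn_integral_crossing_kernel_le[OF \<open>L > 0\<close>, of \<delta> c z w a]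
      unfolding F_def by (cases "z \<in> V") (auto simp: mult_ac)
  qed
  also have "\<dots> \<le> (\<integral>\<^sup>+z. ennreal (K * L powr (1 - \<delta>)) * indicator V z \<partial>lborel)"
    using K by (intro nn_integral_mono) (auto simp: indicator_def)
  also have "\<dots> \<le> ennreal (K * L powr (1 - \<delta>)) * ennreal m"
    using m by (subst nn_integral_cmult_indicator) (auto intro: mult_left_mono)
  also have "\<dots> = ennreal (K * m * L powr (1 - \<delta>))"
    using assms by (subst ennreal_mult[symmetric]) (auto simp: mult_ac)
  finally have "2 * (K * m * L powr (1 - \<delta>)) \<le> K * m * L powr (1 - \<delta>)"
    using assms by (subst (asm) ennreal_le_iff) auto
  then show False using assms by simp
qed

text \<open>A segment from \<open>y\<close> to a point outside \<Omega> crosses the frontier no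
  farther away than that point.\<close>

lemma ball_bdist_subset:
  fixes y :: "'a::euclidean_space"
  assumes "y \<in> \<Omega>"
  shows "ball y (bdist \<Omega> y) \<subseteq> \<Omega>"
proof (rule subsetI, rule ccontr)
  fix p assume p: "p \<in> ball y (bdist \<Omega> y)" "p \<notin> \<Omega>"
  have "closed_segment y p \<inter> frontier \<Omega> \<noteq> {}"
    using assms p by (intro connected_Int_frontier) auto
  then obtain q where q: "q \<in> closed_segment y p" "q \<in> frontier \<Omega>" by auto
  have "bdist \<Omega> y \<le> dist y q" unfolding bdist_def using q by (intro infdist_le)
  also have "\<dots> \<le> dist y p" using segment_bound(1)[OF q(1)] by (simp add: dist_norm norm_minus_commute)
  finally show False using p by simp
qed

lemma bdist_triangle: "bdist \<Omega> x \<le> bdist \<Omega> y + dist x y"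
  unfolding bdist_def by (rule infdist_triangle)

text \<open>The segment from \<open>z\<close> to \<open>w\<close> stays in \<Omega> and contains a
  point \<open>p\<close> of \<open>cball c \<rho>\<close>. Comparing boundary distances at
  \<open>y\<close>, \<open>p\<close> and \<open>c\<close> bounds \<open>bdist \<Omega> y\<close>,
  hence the length of the segment and the distance of \<open>z\<close> from \<open>c\<close>. This
  localisation is what lets the first decay step start from the volume of a ball.\<close>

lemma crossing_pair_location:
  fixes c :: "'a::euclidean_space"
  assumes "U \<subseteq> \<Omega>" "frontier U \<inter> \<Omega> \<subseteq> cball c r0" "r0 + L \<le> \<rho>" "0 < L" "\<tau> < 1"
    and "y \<in> \<Omega>" "norm (z - y) < \<tau> * bdist \<Omega> y" "norm (w - y) < \<tau> * bdist \<Omega> y"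
    and zw: "norm (z - w) < \<tau> * bdist \<Omega> y"
    and z: "z \<in> U" "\<rho> < norm (z - c)" and w: "w \<notin> U - cball c \<rho>"
  shows "norm (z - c) \<le> \<rho> + \<tau> / (1 - \<tau>) * (bdist \<Omega> c + \<rho>)"
    and "norm (w - c) \<le> \<rho> \<or> L \<le> norm (z - w)"
proof -
  have bd: "bdist \<Omega> y \<ge> 0" unfolding bdist_def by (rule infdist_nonneg)
  have sub1: "closed_segment z w \<subseteq> ball y (\<tau> * bdist \<Omega> y)"
    using assms by (intro closed_segment_subset) (auto simp: dist_norm norm_minus_commute)
  have "\<tau> * bdist \<Omega> y \<le> bdist \<Omega> y" using bd assms mult_right_mono[of \<tau> 1 "bdist \<Omega> y"] by simp
  then have sub2: "closed_segment z w \<subseteq> \<Omega>"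
    using sub1 ball_bdist_subset[OF \<open>y \<in> \<Omega>\<close>] by (meson order_trans subset_ball)
  \<comment> \<open>\<open>p\<close> is \<open>w\<close> itself when \<open>w\<close> lies in the
    ball, and otherwise a frontier point of \<open>U\<close> on the segment, which is then within
    \<open>r0\<close> of \<open>c\<close>.\<close>
  obtain p where p: "p \<in> closed_segment z w" "norm (p - c) \<le> \<rho>"
    and or: "norm (w - c) \<le> \<rho> \<or> norm (p - c) \<le> r0"
  proof (cases "norm (w - c) \<le> \<rho>")
    case True
    then show thesis using that[of w] by auto
  next
    case False
    then have "w \<notin> U" using w by (auto simp: dist_norm norm_minus_commute)
    then have "closed_segment z w \<inter> frontier U \<noteq> {}"
      using z by (intro connected_Int_frontier) auto
    then obtain p where "p \<in> closed_segment z w" "p \<in> frontier U" by auto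
    then show thesis using that[of p] assms(2,3,4) sub2
      by (force simp: dist_norm norm_minus_commute)
  qed
  have zp: "norm (z - p) \<le> norm (z - w)"
    using segment_bound(1)[OF p(1)] by (simp add: norm_minus_commute)
  have "dist y p < \<tau> * bdist \<Omega> y" using p sub1 by auto
  then have "(1 - \<tau>) * bdist \<Omega> y \<le> bdist \<Omega> p"
    using bdist_triangle[of \<Omega> y p] by (simp add: algebra_simps)
  also have "\<dots> \<le> bdist \<Omega> c + \<rho>" using bdist_triangle[of \<Omega> p c] p by (simp add: dist_norm)
  finally have bdy: "bdist \<Omega> y \<le> (bdist \<Omega> c + \<rho>) / (1 - \<tau>)" using assms by (simp add: field_simps)
  have \<tau>: "\<tau> > 0"
  proof (rule ccontr)
    assume "\<not> \<tau> > 0"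
    then have "\<tau> * bdist \<Omega> y \<le> 0" using bd by (simp add: mult_nonpos_nonneg)
    then show False using zw norm_ge_zero[of "z - w"] by linarith
  qed
  have "norm (z - c) \<le> norm (p - c) + norm (z - p)"
    using norm_triangle_ineq[of "p - c" "z - p"] by simp
  also have "\<dots> \<le> \<rho> + \<tau> * bdist \<Omega> y" using p zp zw by simp
  also have "\<dots> \<le> \<rho> + \<tau> * ((bdist \<Omega> c + \<rho>) / (1 - \<tau>))" using mult_left_mono[OF bdy, of \<tau>] \<tau> by simp
  finally show "norm (z - c) \<le> \<rho> + \<tau> / (1 - \<tau>) * (bdist \<Omega> c + \<rho>)" by simp
  show "norm (w - c) \<le> \<rho> \<or> L \<le> norm (z - w)"
    using or
  proof
    assume "norm (p - c) \<le> r0"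
    then have "L \<le> norm (z - p)"
      using norm_triangle_ineq[of "p - c" "z - p"] z assms(3) by simp
    then show ?thesis using zp by simp
  qed simp
qed

text \<open>The integrand vanishes unless exactly one of the two points lies in the set. Naming that
  one \<open>z\<close> dominates the integrand by the crossing kernel, and the two possible roles
  account for the factor 2.\<close>

lemma frac_perimeter_diff_cball_le:
  fixes c :: "'a::euclidean_space"
  assumes "U \<subseteq> \<Omega>" "frontier U \<inter> \<Omega> \<subseteq> cball c r0" "r0 + L \<le> \<rho>" "0 < L" "\<tau> < 1"
    and [measurable]: "V \<in> sets borel"
    and V: "\<And>z. z \<in> U \<Longrightarrow> \<rho> < norm (z - c) \<Longrightarrow>
        norm (z - c) \<le> \<rho> + \<tau> / (1 - \<tau>) * (bdist \<Omega> c + \<rho>) \<Longrightarrow> z \<in> V"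
  shows "frac_perimeter \<delta> \<tau> (U - cball c \<rho>) \<Omega>
    \<le> 2 * (\<integral>\<^sup>+z. \<integral>\<^sup>+w. ennreal (crossing_kernel \<delta> c L \<rho> z w) * indicator V z \<partial>lborel \<partial>lborel)"
proof -
  define W where "W = U - cball c \<rho>"
  define F where "F z w = ennreal (crossing_kernel \<delta> c L \<rho> z w) * indicator V z" for z w
  have F_meas: "case_prod F \<in> borel_measurable (lborel \<Otimes>\<^sub>M lborel)"
    unfolding F_def by measurable
  have W_iff: "z \<in> W \<longleftrightarrow> z \<in> U \<and> \<rho> < norm (z - c)" for z
    unfolding W_def by (auto simp: dist_norm norm_minus_commute)
  \<comment> \<open>The point \<open>y\<close> that sets the scale is kept apart from
    \<open>z\<close> and \<open>w\<close>, since the perimeter is not symmetric and \<open>y\<close>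
    may play either role.\<close>
  have key: "ennreal (1 / norm (z - w) powr (real DIM('a) + \<delta>)) \<le> F z w"
    if "y \<in> \<Omega>" "norm (z - y) < \<tau> * bdist \<Omega> y" "norm (w - y) < \<tau> * bdist \<Omega> y"
      "norm (z - w) < \<tau> * bdist \<Omega> y" "z \<in> W" "w \<notin> W" for y z w
  proof -
    have z: "z \<in> U" "\<rho> < norm (z - c)" using that(5) W_iff by auto
    note loc = crossing_pair_location[OF assms(1-5) that(1-4) z that(6)[unfolded W_def]]
    have "z \<in> V" using V z loc(1) .
    then show ?thesis using loc(2) z unfolding F_def crossing_kernel_def by auto
  qed
  have "ennreal (\<bar>indicat_real W x - indicat_real W y\<bar> / norm (x - y) powr (real DIM('a) + \<delta>))
      * indicator {x\<in>\<Omega>. norm (x - y) < \<tau> * bdist \<Omega> y} x * indicator \<Omega> y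
    \<le> F x y + F y x" for x y
  proof (cases "y \<in> \<Omega> \<and> norm (x - y) < \<tau> * bdist \<Omega> y \<and> (x \<in> W) \<noteq> (y \<in> W)")
    case True
    then have t: "0 < \<tau> * bdist \<Omega> y" using norm_ge_zero[of "x - y"] by linarith
    show ?thesis
    proof (cases "x \<in> W")
      case T: True
      then have "ennreal (1 / norm (x - y) powr (real DIM('a) + \<delta>)) \<le> F x y"
        using True t by (intro key[of y]) auto
      then have "ennreal (1 / norm (x - y) powr (real DIM('a) + \<delta>)) \<le> F x y + F y x"
        by (rule order_trans) simp
      then show ?thesis using True T by (auto simp: indicator_def)
    next
      case T: False
      then have "ennreal (1 / norm (y - x) powr (real DIM('a) + \<delta>)) \<le> F y x"
        using True t by (intro key[of y]) (auto simp: norm_minus_commute)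
      then have "ennreal (1 / norm (x - y) powr (real DIM('a) + \<delta>)) \<le> F x y + F y x"
        unfolding norm_minus_commute[of y x] by (rule order_trans) simp
      then show ?thesis using True T by (auto simp: indicator_def)
    qed
  qed (auto simp: indicator_def)
  note pointwise = this
  have "frac_perimeter \<delta> \<tau> W \<Omega> \<le> (\<integral>\<^sup>+y. \<integral>\<^sup>+x. F x y + F y x \<partial>lborel \<partial>lborel)"
    unfolding frac_perimeter_def nn_integral_completion
  proof (rule nn_integral_mono)
    fix y
    show "(\<integral>\<^sup>+x\<in>{x \<in> \<Omega>. norm (x - y) < \<tau> * bdist \<Omega> y}. ennreal (\<bar>indicat_real W x - indicat_real W y\<bar> / norm (x - y) powr (real DIM('a) + \<delta>)) \<partial>lborel) * indicator \<Omega> y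
      \<le> (\<integral>\<^sup>+x. F x y + F y x \<partial>lborel)"
    proof (cases "y \<in> \<Omega>")
      case True
      then show ?thesis using pointwise[of _ y] by (auto intro!: nn_integral_mono)
    qed simp
  qed
  also have "\<dots> = (\<integral>\<^sup>+y. (\<integral>\<^sup>+x. F x y \<partial>lborel) + (\<integral>\<^sup>+x. F y x \<partial>lborel) \<partial>lborel)"
    unfolding F_def by (intro nn_integral_cong nn_integral_add) measurable
  also have "\<dots> = (\<integral>\<^sup>+y. \<integral>\<^sup>+x. F x y \<partial>lborel \<partial>lborel) + (\<integral>\<^sup>+y. \<integral>\<^sup>+x. F y x \<partial>lborel \<partial>lborel)"
    unfolding F_def by (intro nn_integral_add) measurable
  also have "(\<integral>\<^sup>+y. \<integral>\<^sup>+x. F x y \<partial>lborel \<partial>lborel) = (\<integral>\<^sup>+z. \<integral>\<^sup>+w. F z w \<partial>lborel \<partial>lborel)"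
    using lborel_pair.Fubini'[OF F_meas] .
  finally show ?thesis unfolding W_def F_def by (simp add: mult_2)
qed

section \<open>Decay of measure away from the centre of the ball\<close>

text \<open>A good level \<rho> between \<open>a\<close> and \<open>a + L\<close> bounds the
  perimeter of \<open>U - cball c \<rho>\<close>, the content inequality bounds its content, and the
  comparison of content with measure raises this to the power \<open>n / \<beta>\<close>. The
  condition \<open>r0 + L \<le> a\<close> keeps the frontier of \<open>U\<close> in \<Omega> at
  distance at least \<open>L\<close> from the points counted.\<close>

lemma measure_decay_step:
  fixes \<delta> \<tau> \<beta> C :: real
  assumes "0 < \<delta>" "\<delta> < 1" "0 \<le> \<tau>" "\<tau> < 1" "0 < \<beta>" "\<beta> < real DIM('a)" "C > 0"
  obtains K where "K > 0"
    "\<And>(\<Omega>::'a::euclidean_space set) U c r0 a L m.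
      open U \<Longrightarrow> U \<subseteq> \<Omega> \<Longrightarrow> frontier U \<inter> \<Omega> \<subseteq> cball c r0 \<Longrightarrow> r0 + L \<le> a \<Longrightarrow> 0 < L \<Longrightarrow> 0 < m \<Longrightarrow>
      (\<And>\<rho>. hausdorff_content \<beta> (U - cball c \<rho>) \<le> ennreal C * frac_perimeter \<delta> \<tau> (U - cball c \<rho>) \<Omega>) \<Longrightarrow>
      emeasure lborel ((U - cball c a) \<inter> cball c (a + L + \<tau> / (1 - \<tau>) * (bdist \<Omega> c + (a + L)))) \<le> ennreal m \<Longrightarrow>
      emeasure lborel (U - cball c (a + L)) \<le> ennreal (K * (L powr (- \<delta>) * m) powr (real DIM('a) / \<beta>))"
proof -
  define n where "n = real DIM('a)"
  have n1: "n > 0" unfolding n_def by simp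
  define \<omega> where "\<omega> = unit_ball_vol \<beta>"
  have \<omega>: "\<omega> > 0" unfolding \<omega>_def using assms by (intro unit_ball_vol_pos) simp
  define \<omega>n where "\<omega>n = unit_ball_vol n"
  have \<omega>n: "\<omega>n > 0" unfolding \<omega>n_def using n1 by (intro unit_ball_vol_pos) simp
  obtain K where K: "K > 0" "\<And>(z::'a) L. L > 0 \<Longrightarrow>
    (\<integral>\<^sup>+w. ennreal (min L (norm (z - w)) / norm (z - w) powr (real DIM('a) + \<delta>)) \<partial>lborel)
      \<le> ennreal (K * L powr (1 - \<delta>))"
    using nn_integral_kernel_le[OF assms(1,2)] by metis
  \<comment> \<open>The 8 is a product of three factors 2: the choice of the level, the two roles in
    a pair, and the almost optimal covering.\<close>
  define K2 where "K2 = \<omega>n * (8 * C * K / \<omega>) powr (n / \<beta>)"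
  have K2: "K2 > 0" unfolding K2_def using K assms \<omega> \<omega>n by simp
  show thesis
  proof (rule that[OF K2])
    fix \<Omega> U :: "'a set" and c r0 a L m
    assume U: "open U" "U \<subseteq> \<Omega>" "frontier U \<inter> \<Omega> \<subseteq> cball c r0" "r0 + L \<le> a" and L: "0 < L" and m: "0 < m"
      and iso: "\<And>\<rho>. hausdorff_content \<beta> (U - cball c \<rho>) \<le> ennreal C * frac_perimeter \<delta> \<tau> (U - cball c \<rho>) \<Omega>"
      and em: "emeasure lborel ((U - cball c a) \<inter> cball c (a + L + \<tau> / (1 - \<tau>) * (bdist \<Omega> c + (a + L)))) \<le> ennreal m"
    define V where "V = (U - cball c a) \<inter> cball c (a + L + \<tau> / (1 - \<tau>) * (bdist \<Omega> c + (a + L)))"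
    have V: "V \<in> sets borel" unfolding V_def using U by auto
    obtain \<rho> where \<rho>: "a \<le> \<rho>" "\<rho> \<le> a + L"
      and le: "(\<integral>\<^sup>+z. \<integral>\<^sup>+w. ennreal (crossing_kernel \<delta> c L \<rho> z w) * indicator V z \<partial>lborel \<partial>lborel)
        \<le> ennreal (2 * K * m * L powr (- \<delta>))"
      by (rule exists_level_crossing_kernel_le[OF K(1) K(2)[OF L] L m V em[folded V_def]])
    have "frac_perimeter \<delta> \<tau> (U - cball c \<rho>) \<Omega>
      \<le> 2 * (\<integral>\<^sup>+z. \<integral>\<^sup>+w. ennreal (crossing_kernel \<delta> c L \<rho> z w) * indicator V z \<partial>lborel \<partial>lborel)"
    proof (rule frac_perimeter_diff_cball_le[OF U(2,3) _ L assms(4) V])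
      show "r0 + L \<le> \<rho>" using U \<rho> by simp
      fix z assume z: "z \<in> U" "\<rho> < norm (z - c)" "norm (z - c) \<le> \<rho> + \<tau> / (1 - \<tau>) * (bdist \<Omega> c + \<rho>)"
      have "\<tau> / (1 - \<tau>) * (bdist \<Omega> c + \<rho>) \<le> \<tau> / (1 - \<tau>) * (bdist \<Omega> c + (a + L))"
        using \<rho> assms by (intro mult_left_mono) auto
      then show "z \<in> V" unfolding V_def using z \<rho> by (auto simp: dist_norm norm_minus_commute)
    qed
    also have "\<dots> \<le> ennreal 2 * ennreal (2 * K * m * L powr (- \<delta>))"
      using le by (simp add: mult_left_mono)
    also have "\<dots> = ennreal (4 * K * m * L powr (- \<delta>))"
      using K m by (subst ennreal_mult[symmetric]) auto
    finally have P: "frac_perimeter \<delta> \<tau> (U - cball c \<rho>) \<Omega> \<le> ennreal (4 * K * m * L powr (- \<delta>))" .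
    have "hausdorff_content \<beta> (U - cball c \<rho>) \<le> ennreal C * ennreal (4 * K * m * L powr (- \<delta>))"
      using iso[of \<rho>] P by (meson mult_left_mono order_trans zero_le)
    also have "\<dots> = ennreal (C * (4 * K * m * L powr (- \<delta>)))"
      using K m assms by (subst ennreal_mult[symmetric]) auto
    finally have H: "hausdorff_content \<beta> (U - cball c \<rho>) \<le> ennreal (C * (4 * K * m * L powr (- \<delta>)))" .
    have "emeasure lborel (U - cball c (a + L)) \<le> emeasure lborel (U - cball c \<rho>)"
      using U \<rho> by (intro emeasure_mono) auto
    also have "\<dots> \<le> ennreal (unit_ball_vol (real DIM('a)) *
        (2 * (C * (4 * K * m * L powr (- \<delta>))) / unit_ball_vol \<beta>) powr (real DIM('a) / \<beta>))"
      using assms U K m L H by (intro emeasure_le_of_hausdorff_content_le) auto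
    also have "2 * (C * (4 * K * m * L powr (- \<delta>))) / unit_ball_vol \<beta>
        = (8 * C * K / \<omega>) * (L powr (- \<delta>) * m)" unfolding \<omega>_def by simp
    also have "\<dots> powr (real DIM('a) / \<beta>) = (8 * C * K / \<omega>) powr (n / \<beta>) * (L powr (- \<delta>) * m) powr (n / \<beta>)"
      unfolding n_def by (rule powr_mult)
    finally show "emeasure lborel (U - cball c (a + L)) \<le> ennreal (K2 * (L powr (- \<delta>) * m) powr (real DIM('a) / \<beta>))"
      unfolding K2_def \<omega>n_def n_def by (simp add: mult_ac)
  qed
qed

lemma open_eq_empty_of_emeasure:
  fixes S :: "'a::euclidean_space set"
  assumes "open S" "emeasure lborel S = 0"
  shows "S = {}"
proof (rule ccontr)
  assume "S \<noteq> {}"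
  then have "\<not> negligible S" using assms open_not_negligible by blast
  moreover have "S \<in> sets lborel" using assms by auto
  ultimately show False using assms by (simp add: negligible_iff_emeasure0)
qed

text \<open>One step at scale \<open>r\<close> bounds the measure outside
  \<open>cball c (3 * C0 * r)\<close> by \<open>M\<close>, a multiple of
  \<open>r powr ((n - \<delta>) * (n / \<beta>))\<close>. Halving steps then have widths summing to
  a multiple of \<open>M powr e\<close>, that is of \<open>r powr \<sigma>\<close>. What remains
  beyond is open and null.\<close>

lemma subset_cball_of_content_inequality:
  fixes \<delta> \<tau> \<beta> C C0 :: real
  assumes "0 < \<delta>" "\<delta> < 1" "0 \<le> \<tau>" "\<tau> < 1" "real DIM('a) - \<delta> \<le> \<beta>" "\<beta> < real DIM('a)" "C > 0" "C0 \<ge> 1"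
  defines "\<sigma> \<equiv> (real DIM('a) - \<delta>) * (real DIM('a) - \<beta>) / (\<delta> * \<beta>)"
  obtains K where "K > 0"
    "\<And>(\<Omega>::'a::euclidean_space set) U c r.
      open U \<Longrightarrow> U \<subseteq> \<Omega> \<Longrightarrow> 0 < r \<Longrightarrow> r \<le> 1 \<Longrightarrow> bdist \<Omega> c = r \<Longrightarrow> frontier U \<inter> \<Omega> \<subseteq> cball c (C0 * r) \<Longrightarrow>
      (\<And>\<rho>. hausdorff_content \<beta> (U - cball c \<rho>) \<le> ennreal C * frac_perimeter \<delta> \<tau> (U - cball c \<rho>) \<Omega>) \<Longrightarrow>
      U \<subseteq> cball c (K * r powr \<sigma>)"
proof -
  define n where "n = real DIM('a)"
  have n1: "n \<ge> 1" unfolding n_def by (simp add: Suc_leI)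
  have \<beta>: "\<beta> > 0" "n - \<delta> \<le> \<beta>" "\<beta> < n" using assms(2,5,6) n1 unfolding n_def by linarith+
  define \<omega>n where "\<omega>n = unit_ball_vol n"
  have \<omega>n: "\<omega>n > 0" unfolding \<omega>n_def using n1 by (intro unit_ball_vol_pos) simp
  obtain K2 where K2: "K2 > 0"
    and step: "\<And>(\<Omega>::'a set) U c r0 a L m.
      open U \<Longrightarrow> U \<subseteq> \<Omega> \<Longrightarrow> frontier U \<inter> \<Omega> \<subseteq> cball c r0 \<Longrightarrow> r0 + L \<le> a \<Longrightarrow> 0 < L \<Longrightarrow> 0 < m \<Longrightarrow>
      (\<And>\<rho>. hausdorff_content \<beta> (U - cball c \<rho>) \<le> ennreal C * frac_perimeter \<delta> \<tau> (U - cball c \<rho>) \<Omega>) \<Longrightarrow>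
      emeasure lborel ((U - cball c a) \<inter> cball c (a + L + \<tau> / (1 - \<tau>) * (bdist \<Omega> c + (a + L)))) \<le> ennreal m \<Longrightarrow>
      emeasure lborel (U - cball c (a + L)) \<le> ennreal (K2 * (L powr (- \<delta>) * m) powr (n / \<beta>))"
    using measure_decay_step[OF assms(1-4) \<beta>(1) assms(6,7)] unfolding n_def by metis
  \<comment> \<open>\<open>B * r\<close> is the radius of the localising ball for
    \<open>a = 2 * C0 * r\<close>, \<open>L = C0 * r\<close> and
    \<open>bdist \<Omega> c = r\<close>.\<close>
  define B where "B = 3 * C0 + \<tau> / (1 - \<tau>) * (1 + 3 * C0)"
  have B: "B > 0" unfolding B_def using assms by (intro add_pos_nonneg) auto
  define K4 where "K4 = K2 * (C0 powr (- \<delta>) * (\<omega>n * B powr n)) powr (n / \<beta>)"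
  have K4: "K4 > 0" unfolding K4_def using K2 assms \<omega>n B by simp
  \<comment> \<open>\<open>e\<close> and \<open>Kc\<close> come from solving
    \<open>K2 * (L powr (- \<delta>) * m) powr (n / \<beta>) = m / 2\<close> for \<open>L\<close>;
    the solution is \<open>Kc * m powr e\<close>.\<close>
  define e where "e = (n - \<beta>) / (n * \<delta>)"
  have e: "e > 0" unfolding e_def using assms \<beta> n1 by simp
  define Kc where "Kc = (2 * K2) powr (\<beta> / (\<delta> * n))"
  have Kc: "Kc > 0" unfolding Kc_def using K2 by simp
  define p where "p = (1/2::real) powr e"
  have p: "0 < p" "p < 1" using e powr_less_mono2[of e "1/2" 1] unfolding p_def by auto
  define K3 where "K3 = 3 * C0 + Kc * K4 powr e * (1 + 1 / (1 - p))"
  have K3: "K3 > 0" unfolding K3_def using assms Kc K4 p by (intro add_pos_nonneg) auto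
  have \<sigma>: "0 < \<sigma>" "\<sigma> \<le> 1"
  proof -
    show "0 < \<sigma>" unfolding \<sigma>_def n_def[symmetric] using assms \<beta> n1 by simp
    \<comment> \<open>The hypothesis \<open>n - \<delta> \<le> \<beta>\<close> enters twice, the
      second time as \<open>n - \<beta> \<le> \<delta>\<close>.\<close>
    have "(n - \<delta>) * (n - \<beta>) \<le> \<beta> * \<delta>" using assms \<beta> n1 by (intro mult_mono) auto
    then show "\<sigma> \<le> 1" unfolding \<sigma>_def n_def[symmetric] using assms \<beta> by (simp add: mult_ac)
  qed
  have halving: "K2 * ((Kc * m powr e) powr (- \<delta>) * m) powr (n / \<beta>) = m / 2" if m: "m > 0" for m
  proof -
    have "(m powr e) powr (- \<delta>) * m = m powr (1 - (n - \<beta>) / n)"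
      using m assms n1 unfolding e_def by (simp add: powr_powr powr_diff powr_minus_divide)
    also have "1 - (n - \<beta>) / n = \<beta> / n" using n1 by (simp add: field_simps)
    finally have eq: "(m powr e) powr (- \<delta>) * m = m powr (\<beta> / n)" .
    have "(Kc * m powr e) powr (- \<delta>) * m = Kc powr (- \<delta>) * ((m powr e) powr (- \<delta>) * m)"
      by (simp add: powr_mult del: powr_powr)
    then have "((Kc * m powr e) powr (- \<delta>) * m) powr (n / \<beta>)
        = (Kc powr (- \<delta>) * m powr (\<beta> / n)) powr (n / \<beta>)" unfolding eq by (rule arg_cong)
    also have "(Kc powr (- \<delta>) * m powr (\<beta> / n)) powr (n / \<beta>)
        = (Kc powr (- \<delta>)) powr (n / \<beta>) * (m powr (\<beta> / n)) powr (n / \<beta>)"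
      by (rule powr_mult)
    also have "(m powr (\<beta> / n)) powr (n / \<beta>) = m"
      using \<beta> n1 m by (simp add: powr_powr)
    finally have "((Kc * m powr e) powr (- \<delta>) * m) powr (n / \<beta>) = (Kc powr (- \<delta>)) powr (n / \<beta>) * m" .
    also have "(Kc powr (- \<delta>)) powr (n / \<beta>) = (2 * K2) powr (- 1)"
      unfolding Kc_def using \<beta> n1 assms by (simp add: powr_powr)
    also have "\<dots> = 1 / (2 * K2)" using K2 by (simp add: powr_minus_divide)
    finally show ?thesis using K2 by simp
  qed
  show thesis
  proof (rule that[OF K3])
    fix \<Omega> U :: "'a set" and c r
    assume U: "open U" "U \<subseteq> \<Omega>" and r: "0 < r" "r \<le> 1" "bdist \<Omega> c = r"
      and fr: "frontier U \<inter> \<Omega> \<subseteq> cball c (C0 * r)"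
      and iso: "\<And>\<rho>. hausdorff_content \<beta> (U - cball c \<rho>) \<le> ennreal C * frac_perimeter \<delta> \<tau> (U - cball c \<rho>) \<Omega>"
    define M where "M = K4 * r powr ((n - \<delta>) * (n / \<beta>))"
    have M: "M > 0" unfolding M_def using K4 r by simp
    have base: "emeasure lborel (U - cball c (3 * C0 * r)) \<le> ennreal M"
    proof -
      define m where "m = \<omega>n * (B * r) powr n"
      have m: "m > 0" unfolding m_def using \<omega>n B r by simp
      have R: "2 * C0 * r + C0 * r + \<tau> / (1 - \<tau>) * (bdist \<Omega> c + (2 * C0 * r + C0 * r)) = B * r"
        unfolding B_def r(3) by (simp add: algebra_simps)
      have "emeasure lborel ((U - cball c (2 * C0 * r)) \<inter> cball c (B * r)) \<le> emeasure lborel (cball c (B * r))"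
        by (intro emeasure_mono) auto
      also have "\<dots> = ennreal m"
        unfolding m_def \<omega>n_def n_def using B r by (simp add: emeasure_cball powr_realpow)
      finally have V: "emeasure lborel ((U - cball c (2 * C0 * r)) \<inter> cball c (B * r)) \<le> ennreal m" .
      have "emeasure lborel (U - cball c (2 * C0 * r + C0 * r))
          \<le> ennreal (K2 * ((C0 * r) powr (- \<delta>) * m) powr (n / \<beta>))"
        by (rule step[OF U fr _ _ m iso], unfold R)
          (use assms r V in \<open>auto simp del: r(3)\<close>)
      also have "(C0 * r) powr (- \<delta>) * m = (C0 powr (- \<delta>) * (\<omega>n * B powr n)) * r powr (n - \<delta>)"
        unfolding m_def using assms r B by (simp add: powr_mult powr_diff powr_minus_divide)
      also have "K2 * \<dots> powr (n / \<beta>) = M"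
        unfolding M_def K4_def using assms r B \<omega>n by (simp add: powr_mult powr_powr)
      finally show ?thesis by (simp add: algebra_simps)
    qed
    \<comment> \<open>The width of the k-th step, chosen to halve a measure bound
      \<open>M * (1/2)^k\<close>.\<close>
    define W where "W k = Kc * (M * (1/2)^k) powr e" for k :: nat
    have W: "W k > 0" for k unfolding W_def using Kc M by simp
    have W_eq: "W k = W 0 * p ^ k" for k
      unfolding W_def p_def using M by (simp add: powr_mult powr_power powr_realpow[symmetric] powr_powr mult.commute)
    have W_le: "W k \<le> W 0" for k
      using W_eq[of k] W[of 0] p power_le_one[of p k] mult_left_mono[of "p ^ k" 1 "W 0"] by simp
    \<comment> \<open>The extra \<open>W 0\<close> leaves room for the condition
      \<open>C0 * r + W k \<le> a k\<close> at every step, as the widths decrease.\<close>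
    define a where "a k = 3 * C0 * r + W 0 + (\<Sum>j<k. W j)" for k :: nat
    have a_le: "a k \<le> K3 * r powr \<sigma>" for k
    proof -
      have "(\<Sum>j<k. W j) = (\<Sum>j<k. W 0 * p ^ j)" by (rule sum.cong[OF refl W_eq])
      also have "\<dots> = W 0 * (\<Sum>j<k. p ^ j)" by (rule sum_distrib_left[symmetric])
      finally have "(\<Sum>j<k. W j) = W 0 * (\<Sum>j<k. p ^ j)" .
      also have "\<dots> \<le> W 0 * (1 / (1 - p))"
      proof (rule mult_left_mono)
        have "(\<Sum>j<k. p ^ j) = (1 - p ^ k) / (1 - p)" using p by (simp add: sum_gp_strict)
        also have "\<dots> \<le> 1 / (1 - p)" using p by (intro divide_right_mono) auto
        finally show "(\<Sum>j<k. p ^ j) \<le> 1 / (1 - p)" .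
      qed (use W[of 0] in simp)
      finally have 1: "(\<Sum>j<k. W j) \<le> W 0 * (1 / (1 - p))" .
      \<comment> \<open>Since \<open>r \<le> 1\<close> and \<open>\<sigma> \<le> 1\<close>, the
        linear term is absorbed into \<open>r powr \<sigma>\<close>.\<close>
      have "r powr 1 \<le> r powr \<sigma>" using r \<sigma> by (intro powr_mono') auto
      then have 2: "3 * C0 * r \<le> 3 * C0 * r powr \<sigma>" using assms r by simp
      have "(n - \<delta>) * (n / \<beta>) * e = \<sigma>"
        unfolding e_def \<sigma>_def n_def[symmetric] using n1 \<beta> assms by (simp add: field_simps)
      then have 3: "W 0 = Kc * K4 powr e * r powr \<sigma>"
        unfolding W_def M_def using K4 r by (simp add: powr_mult powr_powr)
      have "a k \<le> 3 * C0 * r powr \<sigma> + W 0 * (1 + 1 / (1 - p))"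
        unfolding a_def using 1 2 by (simp add: algebra_simps)
      also have "\<dots> = K3 * r powr \<sigma>" unfolding K3_def 3 by (simp add: algebra_simps)
      finally show ?thesis .
    qed
    have decay: "emeasure lborel (U - cball c (a k)) \<le> ennreal (M * (1/2)^k)" for k
    proof (induction k)
      case 0
      have "emeasure lborel (U - cball c (a 0)) \<le> emeasure lborel (U - cball c (3 * C0 * r))"
        using U W[of 0] by (intro emeasure_mono) (auto simp: a_def)
      then show ?case using base by simp
    next
      case (Suc k)
      have m: "M * (1/2)^k > 0" using M by simp
      have sum: "(\<Sum>j<k. W j) \<ge> 0" using W by (intro sum_nonneg less_imp_le)
      have aS: "a (Suc k) = a k + W k" unfolding a_def by simp
      have "emeasure lborel (U - cball c (a k + W k))
          \<le> ennreal (K2 * (W k powr (- \<delta>) * (M * (1/2)^k)) powr (n / \<beta>))"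
      proof (rule step[OF U fr _ W m iso])
        have "C0 * r \<ge> 0" using assms r by simp
        then show "C0 * r + W k \<le> a k" unfolding a_def using W_le[of k] sum by simp
        have "emeasure lborel ((U - cball c (a k)) \<inter> cball c (a k + W k + \<tau> / (1 - \<tau>) * (bdist \<Omega> c + (a k + W k))))
          \<le> emeasure lborel (U - cball c (a k))"
          using U by (intro emeasure_mono) auto
        then show "emeasure lborel ((U - cball c (a k)) \<inter> cball c (a k + W k + \<tau> / (1 - \<tau>) * (bdist \<Omega> c + (a k + W k))))
          \<le> ennreal (M * (1/2)^k)" using Suc.IH by (rule order_trans)
      qed
      also have "K2 * (W k powr (- \<delta>) * (M * (1/2)^k)) powr (n / \<beta>) = M * (1/2)^Suc k"
        using halving[OF m] unfolding W_def by simp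
      finally show ?case unfolding aS .
    qed
    define E where "E = U - cball c (K3 * r powr \<sigma>)"
    have "emeasure lborel E \<le> ennreal (M * (1/2)^k)" for k
    proof -
      have "emeasure lborel E \<le> emeasure lborel (U - cball c (a k))"
        unfolding E_def using U a_le[of k] by (intro emeasure_mono) auto
      then show ?thesis using decay[of k] by (rule order_trans)
    qed
    moreover have "(\<lambda>k. ennreal (M * (1/2)^k)) \<longlonglongrightarrow> ennreal (M * 0)"
      by (intro tendsto_ennrealI tendsto_mult tendsto_const LIMSEQ_realpow_zero) auto
    ultimately have "emeasure lborel E \<le> ennreal (M * 0)"
      by (intro LIMSEQ_le_const) auto
    then have "E = {}" using U unfolding E_def by (intro open_eq_empty_of_emeasure) auto
    then show "U \<subseteq> cball c (K3 * r powr \<sigma>)" unfolding E_def by auto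
  qed
qed

section \<open>Boundary distance, components and rectifiable curves\<close>

lemma bdist_pos:
  assumes "open \<Omega>" "bounded \<Omega>" "x \<in> \<Omega>"
  shows "0 < bdist \<Omega> x"
proof -
  \<comment> \<open>Boundedness gives a nonempty frontier, which rules out the default value 0 of
    \<open>infdist\<close>.\<close>
  have "\<Omega> \<noteq> UNIV" using assms by auto
  then have "frontier \<Omega> \<noteq> {}" using assms by (auto simp: frontier_eq_empty)
  moreover have "x \<notin> frontier \<Omega>" using assms by (simp add: frontier_def interior_open)
  ultimately show ?thesis unfolding bdist_def by (intro infdist_pos_not_in_closed) auto
qed

text \<open>The frontier of a component lies in the frontier of \<open>\<Omega> - F\<close>, and
  this open set is disjoint from its own frontier.\<close>

lemma frontier_component_Int_subset:
  fixes \<Omega> :: "'a::euclidean_space set"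
  assumes "open \<Omega>" "closed F"
  shows "frontier (connected_component_set (\<Omega> - F) y) \<inter> \<Omega> \<subseteq> F"
proof -
  have "open (\<Omega> - F)" using assms by auto
  then have "frontier (\<Omega> - F) \<inter> (\<Omega> - F) = {}" by (auto simp: frontier_def interior_open)
  then show ?thesis using frontier_of_connected_component_subset[of "\<Omega> - F" y] by blast
qed

text \<open>The derivative is bounded on the unit interval, so the path is Lipschitz there and the
  bounds on inscribed polygons telescope.\<close>

lemma rectifiable_path_polynomial_function:
  fixes p :: "real \<Rightarrow> 'a::euclidean_space"
  assumes "polynomial_function p"
  shows "rectifiable_path p"
proof -
  obtain p' where p': "polynomial_function p'" "\<And>x. (p has_vector_derivative p' x) (at x)"
    using has_vector_derivative_polynomial_function[OF assms] by metis
  have "continuous_on {0..1} p'" using p'(1) by (rule continuous_on_polymonial_function)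
  then have "bounded (p' ` {0..1})"
    by (intro compact_imp_bounded compact_continuous_image) auto
  then obtain B where B: "\<And>x. x \<in> {0..1} \<Longrightarrow> norm (p' x) \<le> B"
    unfolding bounded_iff by blast
  have B0: "B \<ge> 0" using B[of 0] norm_ge_zero[of "p' 0"] by (simp del: norm_ge_zero)
  have lip: "dist (p x) (p y) \<le> B * (y - x)" if "x \<in> {0..1}" "y \<in> {0..1}" "x \<le> y" for x y
  proof -
    have "norm (p x - p y) \<le> B * norm (x - y)"
    proof (rule differentiable_bound[where S = "{0..1}" and f' = "\<lambda>x h. h *\<^sub>R p' x"])
      show "(p has_derivative (\<lambda>h. h *\<^sub>R p' u)) (at u within {0..1})" for u
        using has_vector_derivative_at_within[OF p'(2)] by (simp add: has_vector_derivative_def)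
      show "onorm (\<lambda>h. h *\<^sub>R p' u) \<le> B" if "u \<in> {0..1}" for u
        using B[OF that] B0 by (intro onorm_bound) (auto simp: mult.commute[of B] intro!: mult_left_mono)
    qed (use that in auto)
    then show ?thesis using that by (simp add: dist_norm)
  qed
  show ?thesis unfolding rectifiable_path_def
  proof (intro conjI exI allI impI)
    show "path p" unfolding path_def using assms by (rule continuous_on_polymonial_function)
    fix N :: nat and t :: "nat \<Rightarrow> real"
    assume t: "(\<forall>i\<le>N. t i \<in> {0..1}) \<and> (\<forall>i<N. t i \<le> t (Suc i))"
    have "(\<Sum>i<N. dist (p (t i)) (p (t (Suc i)))) \<le> (\<Sum>i<N. B * (t (Suc i) - t i))"
      using t by (intro sum_mono lip) auto
    also have "\<dots> = B * (t N - t 0)" by (simp add: sum_distrib_left[symmetric] sum_lessThan_telescope)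
    also have "\<dots> \<le> B * 1"
    proof (rule mult_left_mono[OF _ B0])
      have "t N \<le> 1" "0 \<le> t 0" using t by auto
      then show "t N - t 0 \<le> 1" by simp
    qed
    finally show "(\<Sum>i<N. dist (p (t i)) (p (t (Suc i)))) \<le> B" by simp
  qed
qed

text \<open>A uniformly close polynomial path is rectifiable. Since the boundary distance has a
  positive minimum along \<open>g\<close>, the approximation can be so fine that both sides of the
  estimate change only by constant factors.\<close>

lemma rectifiable_path_with_diameter_bound:
  fixes \<Omega> :: "'a::euclidean_space set"
  assumes \<Omega>: "open \<Omega>" "bounded \<Omega>" and s: "0 < s" and A: "0 \<le> A"
    and g: "path g" "path_image g \<subseteq> \<Omega>"
    and le: "\<And>t. t \<in> {0..1} \<Longrightarrow> diameter (g ` {0..t}) powr s \<le> A * bdist \<Omega> (g t)"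
  obtains p where "rectifiable_path p" "path_image p \<subseteq> \<Omega>" "pathstart p = pathstart g"
    "pathfinish p = pathfinish g"
    "\<And>t. t \<in> {0..1} \<Longrightarrow> diameter (p ` {0..t}) powr s < (2 powr s * (2 * (A + 1)) + 1) * bdist \<Omega> (p t)"
proof -
  have g_in: "g t \<in> \<Omega>" if "t \<in> {0..1}" for t using that g by (auto simp: path_image_def)
  have "continuous_on {0..1} (\<lambda>t. bdist \<Omega> (g t))"
    using g unfolding bdist_def path_def by (intro continuous_on_infdist)
  then obtain t0 where t0: "t0 \<in> {0..1}" "\<And>t. t \<in> {0..1} \<Longrightarrow> bdist \<Omega> (g t0) \<le> bdist \<Omega> (g t)"
    using continuous_attains_inf[of "{0..1::real}" "\<lambda>t. bdist \<Omega> (g t)"] by auto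
  define \<eta> where "\<eta> = bdist \<Omega> (g t0)"
  have \<eta>: "\<eta> > 0" unfolding \<eta>_def using bdist_pos[OF \<Omega> g_in[OF t0(1)]] .
  \<comment> \<open>The first entry keeps the boundary distance along \<open>p\<close> at least half
    of that along \<open>g\<close>; the second makes
    \<open>(2 * \<epsilon>) powr s \<le> \<eta>\<close>.\<close>
  define \<epsilon> where "\<epsilon> = min (\<eta> / 2) (\<eta> powr (1 / s) / 2)"
  have \<epsilon>: "\<epsilon> > 0" unfolding \<epsilon>_def using \<eta> by simp
  have "(2 * \<epsilon>) powr s \<le> (\<eta> powr (1 / s)) powr s"
    using \<epsilon> s by (intro powr_mono2) (auto simp: \<epsilon>_def)
  then have \<epsilon>s: "(2 * \<epsilon>) powr s \<le> \<eta>" using \<eta> s by (simp add: powr_powr)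
  obtain p where p: "polynomial_function p" "pathstart p = pathstart g" "pathfinish p = pathfinish g"
    "\<And>t. t \<in> {0..1} \<Longrightarrow> norm (p t - g t) < \<epsilon>"
    using path_approx_polynomial_function[OF g(1) \<epsilon>] by metis
  show thesis
  proof (rule that[of p])
    show "rectifiable_path p" using p(1) by (rule rectifiable_path_polynomial_function)
    show "path_image p \<subseteq> \<Omega>"
    proof (clarsimp simp: path_image_def)
      fix t :: real assume t: "0 \<le> t" "t \<le> 1"
      have "dist (g t) (p t) < \<epsilon>" using p(4)[of t] t by (simp add: dist_norm norm_minus_commute)
      also have "\<epsilon> \<le> bdist \<Omega> (g t)" using t0(2)[of t] t \<eta> by (auto simp: \<epsilon>_def \<eta>_def)
      finally show "p t \<in> \<Omega>" using ball_bdist_subset[OF g_in, of t] t by auto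
    qed
    fix t :: real assume t: "t \<in> {0..1}"
    define r where "r = bdist \<Omega> (g t)"
    have r: "\<eta> \<le> r" unfolding r_def \<eta>_def using t0 t by auto
    have rp: "r / 2 \<le> bdist \<Omega> (p t)"
      using bdist_triangle[of \<Omega> "g t" "p t"] p(4)[OF t] r
      by (simp add: r_def[symmetric] dist_norm norm_minus_commute \<epsilon>_def min_def split: if_splits)
    define D where "D = diameter (g ` {0..t})"
    have bnd: "bounded (g ` {0..t})" using \<Omega>(2) by (rule bounded_subset) (use g_in t in auto)
    have D0: "D \<ge> 0" unfolding D_def using bnd by (rule diameter_ge_0)
    have "diameter (p ` {0..t}) \<le> D + 2 * \<epsilon>"
    proof (rule diameter_le)
      show "p ` {0..t} \<noteq> {} \<or> 0 \<le> D + 2 * \<epsilon>" using D0 \<epsilon> by simp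
      fix x y assume "x \<in> p ` {0..t}" "y \<in> p ` {0..t}"
      then obtain u v where uv: "u \<in> {0..t}" "v \<in> {0..t}" "x = p u" "y = p v" by auto
      have "dist (g u) (g v) \<le> D" unfolding D_def using bnd uv by (intro diameter_bounded_bound) auto
      moreover have "norm (p u - g u) < \<epsilon>" "norm (p v - g v) < \<epsilon>" using p(4) uv t by auto
      moreover have "norm (p u - p v) \<le> norm (p u - g u) + dist (g u) (g v) + norm (p v - g v)"
        by (simp add: dist_norm) norm
      ultimately show "norm (x - y) \<le> D + 2 * \<epsilon>" using uv by simp
    qed
    \<comment> \<open>Passing to the maximum splits the power of the sum at the cost of the factor
      \<open>2 powr s\<close>.\<close>
    also have "D + 2 * \<epsilon> \<le> 2 * max D (2 * \<epsilon>)" by simp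
    finally have "diameter (p ` {0..t}) powr s \<le> (2 * max D (2 * \<epsilon>)) powr s"
      using s \<Omega> by (intro powr_mono2 diameter_ge_0) (auto intro!: compact_imp_bounded compact_continuous_image continuous_on_polymonial_function p(1))
    also have "\<dots> = 2 powr s * max D (2 * \<epsilon>) powr s" by (rule powr_mult)
    also have "\<dots> \<le> 2 powr s * (D powr s + (2 * \<epsilon>) powr s)"
      by (intro mult_left_mono) (auto simp: max_def)
    also have "\<dots> \<le> 2 powr s * (A * r + r)"
      using le[OF t] \<epsilon>s r unfolding D_def r_def by (intro mult_left_mono add_mono) auto
    also have "\<dots> = 2 powr s * (2 * (A + 1)) * (r / 2)" by (simp add: algebra_simps)
    also have "\<dots> \<le> 2 powr s * (2 * (A + 1)) * bdist \<Omega> (p t)"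
      using rp A by (intro mult_left_mono) auto
    \<comment> \<open>The summand 1 in the constant makes the inequality strict, the boundary
      distance being positive.\<close>
    also have "\<dots> < (2 powr s * (2 * (A + 1)) + 1) * bdist \<Omega> (p t)"
      using rp r \<eta> by (simp add: algebra_simps)
    finally show "diameter (p ` {0..t}) powr s < (2 powr s * (2 * (A + 1)) + 1) * bdist \<Omega> (p t)" .
  qed (use p in auto)
qed

section \<open>The John condition along separation curves\<close>

text \<open>Where the curve is near the boundary, an earlier point outside the closed ball lies in a
  component without \<open>x0\<close>, which the content inequality confines to distance
  \<open>K * r powr \<sigma>\<close>. Elsewhere the boundary distance is bounded below and the
  diameter of \<Omega> suffices. As \<open>\<sigma> * s = 1\<close>, taking the power
  \<open>s\<close> gives a bound linear in \<open>r\<close>.\<close>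

lemma diameter_John_domain_of_content_inequality:
  fixes \<Omega> :: "'a::euclidean_space set" and \<delta> \<tau> \<beta> :: real
  assumes dom: "is_domain \<Omega>" and bd: "bounded \<Omega>" and sep: "separation_property \<Omega>"
    and \<delta>: "0 < \<delta>" "\<delta> < 1" and \<tau>: "0 < \<tau>" "\<tau> < 1"
    and \<beta>: "real DIM('a) - \<delta> \<le> \<beta>" "\<beta> < real DIM('a)"
    and content: "\<And>\<gamma>::real. 0 < \<gamma> \<Longrightarrow> \<gamma> < 1 \<Longrightarrow>
           \<exists>C>0. \<forall>U. open U \<and> U \<subseteq> \<Omega> \<and> measure lebesgue U / measure lebesgue \<Omega> \<le> \<gamma> \<longrightarrow>
             hausdorff_content \<beta> U \<le> ennreal (C * (1 - \<delta>)) * frac_perimeter \<delta> \<tau> U \<Omega>"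
  shows "diameter_John_domain (\<delta> * \<beta> / ((real DIM('a) - \<delta>) * (real DIM('a) - \<beta>))) \<Omega>"
proof -
  define n where "n = real DIM('a)"
  have n1: "n \<ge> 1" unfolding n_def by (simp add: Suc_leI)
  have \<beta>': "\<beta> > 0" "n - \<delta> \<le> \<beta>" "\<beta> < n" using \<beta> \<delta> n1 unfolding n_def by linarith+
  define s where "s = \<delta> * \<beta> / ((n - \<delta>) * (n - \<beta>))"
  define \<sigma> where "\<sigma> = (n - \<delta>) * (n - \<beta>) / (\<delta> * \<beta>)"
  have s1: "1 \<le> s"
  proof -
    have "(n - \<delta>) * (n - \<beta>) \<le> \<beta> * \<delta>" using \<delta> \<beta>' n1 by (intro mult_mono) auto
    then show ?thesis unfolding s_def using \<delta> \<beta>' n1 by (simp add: mult_ac)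
  qed
  have \<sigma>s: "\<sigma> * s = 1" unfolding \<sigma>_def s_def using \<delta> \<beta>' n1 by simp
  then have \<sigma>: "0 < \<sigma>" "\<sigma> \<le> 1"
    using s1 zero_less_mult_iff[of \<sigma> s] mult_left_mono[of 1 s \<sigma>] by auto
  have op: "open \<Omega>" and ne: "\<Omega> \<noteq> {}" using dom by (auto simp: is_domain_def)
  obtain x0 C0 where x0: "x0 \<in> \<Omega>" and C0: "C0 \<ge> 1" and curve: "\<And>x. x \<in> \<Omega> \<Longrightarrow> \<exists>\<gamma>.
        path \<gamma> \<and> path_image \<gamma> \<subseteq> \<Omega> \<and> pathstart \<gamma> = x \<and> pathfinish \<gamma> = x0 \<and>
        (\<forall>t\<in>{0..1}. \<gamma> ` {0..t} \<subseteq> ball (\<gamma> t) (C0 * bdist \<Omega> (\<gamma> t)) \<or>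
             (\<forall>y \<in> \<gamma> ` {0..t} - ball (\<gamma> t) (C0 * bdist \<Omega> (\<gamma> t)).
               \<not> connected_component (\<Omega> - frontier (ball (\<gamma> t) (C0 * bdist \<Omega> (\<gamma> t)))) y x0))"
    using sep unfolding separation_property_def Let_def by metis
  define d0 where "d0 = bdist \<Omega> x0"
  have d0: "d0 > 0" unfolding d0_def using bdist_pos[OF op bd x0] .
  define b where "b = ball x0 (d0 / 2)"
  have b_sub: "b \<subseteq> \<Omega>" unfolding b_def
    using ball_bdist_subset[OF x0] d0 by (force simp: d0_def)
  have \<Omega>_m: "\<Omega> \<in> lmeasurable" using op bd by (simp add: lmeasurable_open)
  have b_m: "b \<in> lmeasurable" unfolding b_def by simp
  have b_pos: "measure lebesgue b > 0" unfolding b_def using d0 by (simp add: content_ball_pos)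
  have b_le: "measure lebesgue b \<le> measure lebesgue \<Omega>"
    using b_sub b_m \<Omega>_m by (intro measure_mono_fmeasurable) auto
  \<comment> \<open>Any subset of \<Omega> missing \<open>b\<close> has at most this volume
    fraction, so one constant \<open>C\<close> serves for all points and components. The entry 1/2
    guarantees positivity.\<close>
  define \<gamma>0 where "\<gamma>0 = max (1/2) (1 - measure lebesgue b / measure lebesgue \<Omega>)"
  have \<gamma>0: "0 < \<gamma>0" "\<gamma>0 < 1" unfolding \<gamma>0_def using b_pos b_le by auto
  obtain C where C: "C > 0" and iso: "\<And>U. open U \<Longrightarrow> U \<subseteq> \<Omega> \<Longrightarrow> measure lebesgue U / measure lebesgue \<Omega> \<le> \<gamma>0 \<Longrightarrow>
             hausdorff_content \<beta> U \<le> ennreal (C * (1 - \<delta>)) * frac_perimeter \<delta> \<tau> U \<Omega>"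
    using content[OF \<gamma>0] by metis
  have C\<delta>: "C * (1 - \<delta>) > 0" using C \<delta> by simp
  have iso': "hausdorff_content \<beta> U \<le> ennreal (C * (1 - \<delta>)) * frac_perimeter \<delta> \<tau> U \<Omega>"
    if U: "open U" "U \<subseteq> \<Omega>" "U \<inter> b = {}" for U
  proof (rule iso[OF U(1,2)])
    have "measure lebesgue U \<le> measure lebesgue (\<Omega> - b)"
      using U \<Omega>_m b_m by (intro measure_mono_fmeasurable fmeasurable_Diff) auto
    also have "\<dots> = measure lebesgue \<Omega> - measure lebesgue b"
      using \<Omega>_m b_m b_sub by (intro measurable_measure_Diff) auto
    finally have "measure lebesgue U / measure lebesgue \<Omega>
        \<le> (measure lebesgue \<Omega> - measure lebesgue b) / measure lebesgue \<Omega>"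
      by (intro divide_right_mono) auto
    also have "\<dots> = 1 - measure lebesgue b / measure lebesgue \<Omega>"
      using b_pos b_le by (simp add: diff_divide_distrib)
    also have "\<dots> \<le> \<gamma>0" unfolding \<gamma>0_def by simp
    finally show "measure lebesgue U / measure lebesgue \<Omega> \<le> \<gamma>0" .
  qed
  obtain K where K: "K > 0" and K_sub: "\<And>(\<Omega>::'a set) U c r.
      open U \<Longrightarrow> U \<subseteq> \<Omega> \<Longrightarrow> 0 < r \<Longrightarrow> r \<le> 1 \<Longrightarrow> bdist \<Omega> c = r \<Longrightarrow> frontier U \<inter> \<Omega> \<subseteq> cball c (C0 * r) \<Longrightarrow>
      (\<And>\<rho>. hausdorff_content \<beta> (U - cball c \<rho>) \<le> ennreal (C * (1 - \<delta>)) * frac_perimeter \<delta> \<tau> (U - cball c \<rho>) \<Omega>) \<Longrightarrow>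
      U \<subseteq> cball c (K * r powr \<sigma>)"
    using subset_cball_of_content_inequality[OF \<delta> less_imp_le[OF \<tau>(1)] \<tau>(2) \<beta> C\<delta> C0]
    unfolding \<sigma>_def n_def by blast
  \<comment> \<open>The maximum covers both the points within \<open>C0 * r\<close> and those in a
    component avoiding \<open>x0\<close>.\<close>
  define K' where "K' = max K C0"
  \<comment> \<open>The bound 1 provides \<open>r \<le> 1\<close>; the other entry keeps the sphere
    of radius \<open>C0 * r\<close> away from \<open>b\<close>.\<close>
  define c1 where "c1 = min 1 (d0 / (4 * C0))"
  have c1: "c1 > 0" "c1 \<le> 1" unfolding c1_def using d0 C0 by auto
  have far: "U \<subseteq> cball c (K * bdist \<Omega> c powr \<sigma>)"
    if c: "c \<in> \<Omega>" and small: "bdist \<Omega> c \<le> c1" and F: "F = frontier (ball c (C0 * bdist \<Omega> c))"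
      and U: "U = connected_component_set (\<Omega> - F) y" and x0U: "x0 \<notin> U" for c F U y
  proof -
    define r where "r = bdist \<Omega> c"
    have r: "r > 0" unfolding r_def using bdist_pos[OF op bd c] .
    have C0r: "C0 * r > 0" using C0 r by simp
    have F_eq: "F = sphere c (C0 * r)" unfolding F r_def[symmetric] using C0r by simp
    have op': "open (\<Omega> - F)" using op unfolding F_eq by auto
    have "r \<le> d0 / (4 * C0)" using small unfolding r_def c1_def by simp
    then have C0r_le: "C0 * r \<le> d0 / 4" using C0 by (simp add: field_simps)
    moreover have "r \<le> C0 * r" using C0 r by simp
    moreover have "d0 \<le> r + dist x0 c" unfolding d0_def r_def by (rule bdist_triangle)
    \<comment> \<open>The centre \<open>c\<close> is at least \<open>3 * d0 / 4\<close> from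
      \<open>x0\<close> and the radius is at most \<open>d0 / 4\<close>, so the sphere stays at
      distance at least \<open>d0 / 2\<close> from \<open>x0\<close>.\<close>
    ultimately have "b \<inter> F = {}" unfolding b_def F_eq
    proof -
      assume *: "C0 * r \<le> d0 / 4" "r \<le> C0 * r" "d0 \<le> r + dist x0 c"
      have "z \<notin> sphere c (C0 * r)" if "z \<in> ball x0 (d0 / 2)" for z
        using that dist_triangle[of x0 c z] * by (auto simp: dist_commute)
      then show "ball x0 (d0 / 2) \<inter> sphere c (C0 * r) = {}" by blast
    qed
    then have b_sub': "b \<subseteq> \<Omega> - F" using b_sub by auto
    \<comment> \<open>The ball \<open>b\<close> is connected and avoids \<open>F\<close>, so a
      component meeting it would contain \<open>x0\<close>.\<close>
    have "U \<inter> b = {}"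
    proof (rule ccontr)
      assume "U \<inter> b \<noteq> {}"
      then obtain u where u: "u \<in> U" "u \<in> b" by auto
      have "x0 \<in> b" unfolding b_def using d0 by simp
      then have "connected_component (\<Omega> - F) u x0"
        using u b_sub' unfolding connected_component_def b_def by (intro exI[of _ b]) (auto simp: b_def)
      moreover have "connected_component (\<Omega> - F) y u" using u U by simp
      ultimately have "x0 \<in> U" unfolding U by (auto intro: connected_component_trans)
      then show False using x0U by simp
    qed
    moreover have opU: "open U" unfolding U using op' by (rule open_connected_component)
    moreover have subU: "U \<subseteq> \<Omega>" unfolding U using connected_component_subset[of "\<Omega> - F" y] by auto
    ultimately have iso'': "hausdorff_content \<beta> (U - cball c \<rho>)
        \<le> ennreal (C * (1 - \<delta>)) * frac_perimeter \<delta> \<tau> (U - cball c \<rho>) \<Omega>" for \<rho>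
      by (intro iso') auto
    have "frontier U \<inter> \<Omega> \<subseteq> F" unfolding U
      using op by (rule frontier_component_Int_subset) (simp add: F_eq)
    also have "F \<subseteq> cball c (C0 * r)" unfolding F_eq by auto
    finally have "frontier U \<inter> \<Omega> \<subseteq> cball c (C0 * r)" .
    then have "U \<subseteq> cball c (K * r powr \<sigma>)"
      using small c1 r by (intro K_sub[OF opU subU _ _ _ _ iso'']) (auto simp: r_def)
    then show ?thesis unfolding r_def .
  qed
  \<comment> \<open>The two entries serve the cases \<open>r \<le> c1\<close> and
    \<open>r > c1\<close>; the 2 passes from radius to diameter.\<close>
  define A where "A = max ((2 * K') powr s) (diameter \<Omega> powr s / c1)"
  have A: "A \<ge> 0" unfolding A_def by (rule max.coboundedI1) simp
  define CJ where "CJ = 2 powr s * (2 * (A + 1)) + 1"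
  have CJ: "CJ \<ge> 1" unfolding CJ_def using A by simp
  have John: "\<exists>p. rectifiable_path p \<and> path_image p \<subseteq> \<Omega> \<and> pathstart p = x \<and> pathfinish p = x0 \<and>
        (\<forall>t\<in>{0..1}. CJ * bdist \<Omega> (p t) > diameter (p ` {0..t}) powr s)" if x: "x \<in> \<Omega>" for x
  proof -
    obtain g where g: "path g" "path_image g \<subseteq> \<Omega>" "pathstart g = x" "pathfinish g = x0"
      and alt: "\<And>t. t \<in> {0..1} \<Longrightarrow> g ` {0..t} \<subseteq> ball (g t) (C0 * bdist \<Omega> (g t)) \<or>
             (\<forall>y \<in> g ` {0..t} - ball (g t) (C0 * bdist \<Omega> (g t)).
               \<not> connected_component (\<Omega> - frontier (ball (g t) (C0 * bdist \<Omega> (g t)))) y x0)"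
      using curve[OF x] by metis
    have g_in: "g t \<in> \<Omega>" if "t \<in> {0..1}" for t using that g by (auto simp: path_image_def)
    have "diameter (g ` {0..t}) powr s \<le> A * bdist \<Omega> (g t)" if t: "t \<in> {0..1}" for t
    proof -
      define r where "r = bdist \<Omega> (g t)"
      have r: "r > 0" unfolding r_def using bdist_pos[OF op bd g_in[OF t]] .
      have sub: "g ` {0..t} \<subseteq> \<Omega>" using g_in t by auto
      have D0: "diameter (g ` {0..t}) \<ge> 0" using bounded_subset[OF bd sub] by (rule diameter_ge_0)
      show ?thesis
      proof (cases "r \<le> c1")
        case True
        have "r powr 1 \<le> r powr \<sigma>" using r \<sigma> True c1 by (intro powr_mono') auto
        then have r_le: "C0 * r \<le> K' * r powr \<sigma>"
          using C0 r by (intro mult_mono) (auto simp: K'_def)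
        have in_ball: "dist (g t) y \<le> K' * r powr \<sigma>" if y: "y \<in> g ` {0..t}" for y
        \<comment> \<open>Splitting by the closed ball puts the points of the sphere, which lie in
          no component, into the trivial case.\<close>
        proof (cases "dist (g t) y \<le> C0 * r")
          case True
          then show ?thesis using r_le by simp
        next
          case False
          define F where "F = frontier (ball (g t) (C0 * r))"
          have F_eq: "F = sphere (g t) (C0 * r)" unfolding F_def using C0 r by simp
          have yF: "y \<in> \<Omega> - F" unfolding F_eq using False sub y by auto
          define U where "U = connected_component_set (\<Omega> - F) y"
          have "\<not> connected_component (\<Omega> - F) y x0"
            using alt[OF t] y False unfolding F_def r_def by auto
          then have "x0 \<notin> U" unfolding U_def by simp
          then have "U \<subseteq> cball (g t) (K * r powr \<sigma>)"
            unfolding r_def by (rule far[OF g_in[OF t] True[unfolded r_def] F_def[unfolded r_def] U_def])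
          moreover have "y \<in> U" unfolding U_def using yF by simp
          ultimately have "dist (g t) y \<le> K * r powr \<sigma>" by auto
          also have "\<dots> \<le> K' * r powr \<sigma>" unfolding K'_def by (intro mult_right_mono) auto
          finally show ?thesis .
        qed
        have "diameter (g ` {0..t}) \<le> 2 * K' * r powr \<sigma>"
        proof (rule diameter_le)
          show "g ` {0..t} \<noteq> {} \<or> 0 \<le> 2 * K' * r powr \<sigma>" using t by simp
          fix y z assume "y \<in> g ` {0..t}" "z \<in> g ` {0..t}"
          then show "norm (y - z) \<le> 2 * K' * r powr \<sigma>"
            using in_ball[of y] in_ball[of z] dist_triangle2[of y z "g t"]
            by (simp add: dist_norm norm_minus_commute)
        qed
        then have "diameter (g ` {0..t}) powr s \<le> (2 * K' * r powr \<sigma>) powr s"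
          using D0 s1 by (intro powr_mono2) auto
        also have "\<dots> = (2 * K') powr s * r"
          using r by (simp add: powr_mult powr_powr \<sigma>s)
        also have "\<dots> \<le> A * r" using r by (intro mult_right_mono) (auto simp: A_def)
        finally show ?thesis unfolding r_def .
      next
        case False
        have "diameter (g ` {0..t}) powr s \<le> diameter \<Omega> powr s"
          using D0 s1 sub bd by (intro powr_mono2 diameter_subset) auto
        also have "\<dots> = diameter \<Omega> powr s / c1 * c1" using c1 by simp
        also have "\<dots> \<le> A * r" using False c1 A by (intro mult_mono) (auto simp: A_def)
        finally show ?thesis unfolding r_def .
      qed
    qed
    then obtain p where "rectifiable_path p" "path_image p \<subseteq> \<Omega>" "pathstart p = pathstart g"
        "pathfinish p = pathfinish g"
        "\<And>t. t \<in> {0..1} \<Longrightarrow> diameter (p ` {0..t}) powr s < CJ * bdist \<Omega> (p t)"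
      using rectifiable_path_with_diameter_bound[OF op bd _ A g(1,2), of s] s1
      unfolding CJ_def by (metis less_le_trans zero_less_one)
    then show ?thesis using g by (intro exI[of _ p]) auto
  qed
  have "diameter_John_domain s \<Omega>"
    unfolding diameter_John_domain_def using s1 dom bd CJ x0 John by blast
  then show ?thesis unfolding s_def n_def .
qed

theorem theorem1p10:
  fixes \<Omega> :: "(real ^ 'n) set" and \<delta> \<tau> \<beta> :: real
  assumes "CARD('n) \<ge> 2"
    and "is_domain \<Omega>" and "bounded \<Omega>"
    and "separation_property \<Omega>"
    and "0 < \<delta>" and "\<delta> < 1" and "0 < \<tau>" and "\<tau> < 1"
    and "real CARD('n) - \<delta> \<le> \<beta>" and "\<beta> < real CARD('n)"
    and "\<And>\<gamma>::real. 0 < \<gamma> \<Longrightarrow> \<gamma> < 1 \<Longrightarrow>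
           \<exists>C>0. \<forall>U. open U \<and> U \<subseteq> \<Omega> \<and> measure lebesgue U / measure lebesgue \<Omega> \<le> \<gamma> \<longrightarrow>
             hausdorff_content \<beta> U \<le> ennreal (C * (1 - \<delta>)) * frac_perimeter \<delta> \<tau> U \<Omega>"
  shows "diameter_John_domain
           (\<delta> * \<beta> / ((real CARD('n) - \<delta>) * (real CARD('n) - \<beta>))) \<Omega>"
proof -
  have D: "DIM(real ^ 'n) = CARD('n)" by simp
  show ?thesis
    by (rule diameter_John_domain_of_content_inequality[where 'a = "real ^ 'n", unfolded D, OF assms(2-11)])
qed

end
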